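(* Let $X,Y,Z$ be finite random variables with joint distribution $P_{XYZ}$ that is private and bi-disjoint between $XY$ and $Z$ (definitions in the context). Then a secret key rate of $$I(X:Z)-I(X:Y)=H(X|Y)-H(X|Z)$$ is necessary and sufficient for distribution merging of $P_{XYZ}$ from Alice (holding $X$) to Bob (holding $Y$). That is, the infimum of the secret key rates of asymptotically successful distribution merging protocols equals $I(X:Z)-I(X:Y)$. In particular: - when this quantity is nonnegative, it is the minimum rate of secret key consumed by an optimal merging protocol; - when it is negative, distribution merging can be achieved while $I(X:Y)-I(X:Z)$ bits of secret key per copy remain at the end of the protocol, and no protocol leaves more.
   Context: Notation. $H$ is Shannon entropy (base 2), $H(X|Y)=H(XY)-H(Y)$, and $I(X:Y)=H(X)+H(Y)-H(XY)$ is the mutual information. Parties. Alice holds $X$, Bob holds $Y$, a reference party $R$ holds $Z$, and an eavesdropper $E$ holds a random variable $E$. The distribution is private: $P_{XYZE}=P_{XYZ}\otimes P_E$. Bi-disjointness. Write $T=XY$. The distribution $P_{TZ}$ is bi-disjoint if it can be written as $$P_{TZ}(t,z)=\sum_i p(i)\,P_{T|I=i}(t)\,P_{Z|I=i}(z)$$ for some probability distribution $p$ on labels $i$ and conditional distributions $P_{T|I}$, $P_{Z|I}$ satisfying $P_{T|I=i}(t)P_{T|I=j}(t)=0$ and $P_{Z|I=i}(z)P_{Z|I=j}(z)=0$ for all $t,z$ whenever $i\neq j$. Secret key. A secret key bit is the distribution $\overline\Psi_{UV}(0,0)=\overline\Psi_{UV}(1,1)=1/2$ shared by Alice ($U$)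 and Bob ($V$), independent of all other parties. Allowed operations (LOPC). These are local operations, meaning local randomness and local stochastic processing, together with public communication. The eavesdropper receives a copy of every public message. Distribution merging. Given $n$ i.i.d. copies $X^nY^nZ^nE^n$ of $P_{XYZE}$, a protocol may use $k$ bits of secret key plus free LOPC. At the end: - Alice holds $\widehat U^l$; - Bob holds $\widehat V^l\widehat X^n\widehat Y^n$; - the reference still holds $Z^n$; - the eavesdropper holds $\widehat E^n$. The protocol produces a joint distribution $P'_{\widehat U^l(\widehat X^n\widehat Y^n\widehat V^l)Z^n\widehat E^n}$, and it succeeds if $P'$ approximates $P_{XYZE}^{\otimes n}\otimes\overline\Psi_{UV}^{\otimes l}$ in total variation ($\ell^1$) distance, with error tending to $0$ as $n\to\infty$. Here $l$ is the number of secret key bits shared by Alice and Bob at the end. The secret key rate of the protocol is $\frac1n(k-l)$, which may be negative. A rate is achievable if there are successful protocols (error $\to0$ as $n\to\infty$) whose secret key rates approach it asymptotically. *)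

theory Defs
  imports "HOL-Probability.Probability"
begin

definition shannon_H :: "'a::finite pmf \<Rightarrow> real" where
  "shannon_H p = - (\<Sum>a\<in>UNIV. (if pmf p a = 0 then 0 else pmf p a * log 2 (pmf p a)))"

definition mutual_info :: "('a::finite \<times> 'b::finite) pmf \<Rightarrow> real" where
  "mutual_info p = shannon_H (map_pmf fst p) + shannon_H (map_pmf snd p) - shannon_H p"

definition bi_disjoint :: "(('x \<times> 'y) \<times> 'z) pmf \<Rightarrow> bool" where
  "bi_disjoint P \<longleftrightarrow>
     (\<exists>(L::nat set) (p::nat \<Rightarrow> real) (PT::nat \<Rightarrow> ('x \<times> 'y) pmf) (PZ::nat \<Rightarrow> 'z pmf).
        finite L \<and> (\<forall>i\<in>L. p i \<ge> 0) \<and> (\<Sum>i\<in>L. p i) = 1 \<and>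
        (\<forall>i\<in>L. \<forall>j\<in>L. i \<noteq> j \<longrightarrow>
            (\<forall>t. pmf (PT i) t * pmf (PT j) t = 0) \<and> (\<forall>z. pmf (PZ i) z * pmf (PZ j) z = 0)) \<and>
        (\<forall>t z. pmf P (t, z) = (\<Sum>i\<in>L. p i * pmf (PT i) t * pmf (PZ i) z)))"

primrec iid_pmf :: "nat \<Rightarrow> 'a pmf \<Rightarrow> 'a list pmf" where
  "iid_pmf 0 p = return_pmf []"
| "iid_pmf (Suc n) p = do { x \<leftarrow> p; xs \<leftarrow> iid_pmf n p; return_pmf (x # xs) }"

definition key_pmf :: "nat \<Rightarrow> bool list pmf" where
  "key_pmf k = pmf_of_set {ks. length ks = k}"

definition l1_dist :: "'a pmf \<Rightarrow> 'a pmf \<Rightarrow> real" where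
  "l1_dist p q = infsum (\<lambda>a. \<bar>pmf p a - pmf q a\<bar>) UNIV"

text \<open>A general LOPC protocol on n copies with a pre-shared secret key.
  Local randomness of Alice / Bob is sampled once at the start (any discrete
  distribution, encoded in nat); all later actions are deterministic functions of
  the party's data, the shared key, its local randomness and the public transcript
  so far.  Public messages (nat-encoded, arbitrary countable alphabet) are sent in
  rounds, Alice speaking in even rounds and Bob in odd rounds (empty/constant
  messages allow any speaking pattern).  At the end Alice outputs U^l and Bob
  outputs V^l together with his copy of X^n Y^n.\<close>

record ('x, 'y) lopc =
  randA :: "nat pmf"
  randB :: "nat pmf"
  nrounds :: nat
  msgA :: "'x list \<Rightarrow> bool list \<Rightarrow> nat \<Rightarrow> nat list \<Rightarrow> nat"
  msgB :: "'y list \<Rightarrow> bool list \<Rightarrow> nat \<Rightarrow> nat list \<Rightarrow> nat"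
  outA :: "'x list \<Rightarrow> bool list \<Rightarrow> nat \<Rightarrow> nat list \<Rightarrow> bool list"
  outB :: "'y list \<Rightarrow> bool list \<Rightarrow> nat \<Rightarrow> nat list \<Rightarrow> bool list \<times> ('x \<times> 'y) list"

primrec transcript ::
  "('x, 'y) lopc \<Rightarrow> 'x list \<Rightarrow> 'y list \<Rightarrow> bool list \<Rightarrow> nat \<Rightarrow> nat \<Rightarrow> nat \<Rightarrow> nat list" where
  "transcript prot xs ys key a b 0 = []"
| "transcript prot xs ys key a b (Suc t) =
     (let tr = transcript prot xs ys key a b t
      in tr @ [if even t then msgA prot xs key a tr else msgB prot ys key b tr])"

text \<open>Final joint distribution of (Alice's U^l, Bob's (V^l, X^n Y^n), reference Z^n,
  eavesdropper's view = (E^n, public transcript)), starting from n i.i.d. copies of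
  P_{XYZ} (x) P_E and k shared secret key bits.\<close>
definition lopc_output ::
  "('x \<times> 'y \<times> 'z) pmf \<Rightarrow> 'e pmf \<Rightarrow> nat \<Rightarrow> nat \<Rightarrow> ('x, 'y) lopc \<Rightarrow>
   (bool list \<times> (bool list \<times> ('x \<times> 'y) list) \<times> 'z list \<times> 'e list \<times> nat list) pmf" where
  "lopc_output P PE n k prot = do {
     t \<leftarrow> iid_pmf n P;
     es \<leftarrow> iid_pmf n PE;
     key \<leftarrow> key_pmf k;
     a \<leftarrow> randA prot;
     b \<leftarrow> randB prot;
     let xs = map fst t;
     let ys = map (fst \<circ> snd) t;
     let zs = map (snd \<circ> snd) t;
     let tr = transcript prot xs ys key a b (nrounds prot);
     return_pmf (outA prot xs key a tr, outB prot ys key b tr, zs, es, tr) }"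

definition merge_target ::
  "('x \<times> 'y \<times> 'z) pmf \<Rightarrow> 'e pmf \<Rightarrow> nat \<Rightarrow> nat \<Rightarrow> nat list pmf \<Rightarrow>
   (bool list \<times> (bool list \<times> ('x \<times> 'y) list) \<times> 'z list \<times> 'e list \<times> nat list) pmf" where
  "merge_target P PE n l Q = do {
     t \<leftarrow> iid_pmf n P;
     es \<leftarrow> iid_pmf n PE;
     key \<leftarrow> key_pmf l;
     tr \<leftarrow> Q;
     return_pmf (key, (key, map (\<lambda>(x, y, z). (x, y)) t), map (snd \<circ> snd) t, es, tr) }"

definition merge_error ::
  "('x \<times> 'y \<times> 'z) pmf \<Rightarrow> 'e pmf \<Rightarrow> nat \<Rightarrow> nat \<Rightarrow> nat \<Rightarrow> ('x, 'y) lopc \<Rightarrow> nat list pmf \<Rightarrow> real" where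
  "merge_error P PE n k l prot Q = l1_dist (lopc_output P PE n k prot) (merge_target P PE n l Q)"

definition merging_achievable :: "('x \<times> 'y \<times> 'z) pmf \<Rightarrow> 'e pmf \<Rightarrow> real \<Rightarrow> bool" where
  "merging_achievable P PE R \<longleftrightarrow>
     (\<exists>(k::nat \<Rightarrow> nat) (l::nat \<Rightarrow> nat) (prot::nat \<Rightarrow> ('x, 'y) lopc) (Q::nat \<Rightarrow> nat list pmf).
        (\<lambda>n. merge_error P PE n (k n) (l n) (prot n) (Q n)) \<longlonglongrightarrow> 0 \<and>
        (\<lambda>n. (real (k n) - real (l n)) / real n) \<longlonglongrightarrow> R)"

end

(*
  Bi-disjointness makes XY and Z conditionally independent given a label J that is a function
  of XY and also a function of Z.  With I(XY:Z) = H(J), the rate is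
  I(X:Z) - I(X:Y) = H(J) - I(XZ:Y) = H(X|Y) - H(X|Z).

  Achievability.  Alice sends a random-binning hash of X^n of about n H(X|Y) bits, encrypted with
  a one-time pad.  Bob decodes X^n, computes J^n and draws fresh (X^n, Y^n) given J^n; this
  has the right joint law with Z^n.  The original X^n then only survives in the key, and privacy
  amplification extracts about n H(X|Z) bits from it that are independent of Z^n.

  Converse.  Let the reference join Alice.  A transcript of public discussion is compatible with
  a rectangle of inputs, so for typical inputs the probability that the transcript is t and both
  parties hold the value w is at most M a_t(w) b_t(w), where M = 2^(k + n I(XZ:Y)) bounds the
  likelihood ratio of the true inputs against independent ones.  The target gives this event
  the probability Q(t) p(w), where w = (key, J^n) and p(w) is about c = 2^(-l - n H(J)).  Summing
  min(Q p, M a b), which is at most the geometric mean, and applying Cauchy-Schwarz shows that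
  1 - o(1) <= sqrt (M c).
*)
theory Submission
  imports Defs "HOL-Real_Asymp.Real_Asymp"
begin

text \<open>The converse reduces merging to key agreement. In the target, the reference and Bob
  share J^n, and this value is independent of the transcript. With the reference on Alice's side,
  merging thus leaves l + n H(J) bits of secret key, whereas the parties start with k shared bits
  and n I(XZ:Y) bits of correlation. Bob's copy of X^n Y^n is tested only through its labels.

  An entropy argument in the style of Fano loses a term of order error times l. Here k and l may
  grow faster than linearly in n, with only k - l controlled, and messages come from an infinite
  alphabet. The bound is therefore one-shot: k and l enter through 2^(k - l) alone, and the error is
  not multiplied by any alphabet size.

  In the protocol, hash and extracted key are functions of the same X^n. The pad makes the public
  message independent of X^n, so the extracted key has to be independent of Z^n only, and its rate
  is the full H(X|Z).\<close>

section \<open>Total variation distance\<close>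

lemma expectation_count_space:
  fixes h :: "'a \<Rightarrow> real"
  shows "measure_pmf.expectation p h = (\<integral>x. pmf p x * h x \<partial>count_space UNIV)"
  unfolding measure_pmf_eq_density by (subst integral_density) simp_all

lemma integrable_pmf_bounded:
  fixes h :: "'a \<Rightarrow> real"
  assumes "\<And>x. \<bar>h x\<bar> \<le> 1"
  shows "integrable (count_space UNIV) (\<lambda>x. pmf p x * h x)"
  by (rule Bochner_Integration.integrable_bound[OF integrable_pmf[of UNIV p]])
     (use assms in \<open>auto simp: abs_mult intro!: mult_left_le\<close>)

lemma l1_dist_integral: "l1_dist p q = (\<integral>x. \<bar>pmf p x - pmf q x\<bar> \<partial>count_space UNIV)"
proof -
  have "integrable (count_space UNIV) (\<lambda>x. \<bar>pmf p x - pmf q x\<bar>)"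
    by (intro integrable_abs Bochner_Integration.integrable_diff integrable_pmf)
  then have "Infinite_Set_Sum.abs_summable_on (\<lambda>x. \<bar>pmf p x - pmf q x\<bar>) UNIV"
    by (simp add: Infinite_Set_Sum.abs_summable_on_def)
  from infsetsum_infsum[OF this] show ?thesis
    by (simp add: l1_dist_def infsetsum_def)
qed

lemma expectation_diff_le_l1:
  fixes h :: "'a \<Rightarrow> real"
  assumes h: "\<And>x. \<bar>h x\<bar> \<le> 1"
  shows "measure_pmf.expectation p h - measure_pmf.expectation q h \<le> l1_dist p q"
proof -
  note int = integrable_pmf_bounded[of h, OF h]
  have "measure_pmf.expectation p h - measure_pmf.expectation q h
      = (\<integral>x. pmf p x * h x - pmf q x * h x \<partial>count_space UNIV)"
    unfolding expectation_count_space by (rule Bochner_Integration.integral_diff[symmetric]; rule int)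
  also have "\<dots> \<le> (\<integral>x. \<bar>pmf p x - pmf q x\<bar> \<partial>count_space UNIV)"
  proof (rule integral_mono)
    show "pmf p x * h x - pmf q x * h x \<le> \<bar>pmf p x - pmf q x\<bar>" for x
    proof -
      have "pmf p x * h x - pmf q x * h x \<le> \<bar>pmf p x - pmf q x\<bar> * \<bar>h x\<bar>"
        by (metis abs_ge_self abs_mult left_diff_distrib)
      also have "\<dots> \<le> \<bar>pmf p x - pmf q x\<bar>" by (intro mult_left_le h) auto
      finally show ?thesis .
    qed
  qed (auto intro!: int integrable_pmf)
  finally show ?thesis by (simp add: l1_dist_integral)
qed

lemma expectation_signed_indicator:
  "measure_pmf.expectation p (\<lambda>x. 2 * indicat_real A x - 1) = 2 * measure_pmf.prob p A - 1"
proof -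
  have "integrable (measure_pmf p) (indicat_real A)"
    by (rule measure_pmf.integrable_const_bound[where B=1]) (auto simp: indicator_def)
  then show ?thesis by (simp add: measure_pmf.prob_space)
qed

text \<open>The sign of \<open>pmf p x - pmf q x\<close> is a test function with values 1 and -1, so
  the absolute values become a difference of expectations. Later bounds on the distance only have to
  control one event.\<close>

lemma l1_dist_attained:
  "l1_dist p q = 2 * (measure_pmf.prob p {x. pmf q x < pmf p x} - measure_pmf.prob q {x. pmf q x < pmf p x})"
proof -
  define A where "A = {x. pmf q x < pmf p x}"
  let ?s = "\<lambda>x. 2 * indicat_real A x - 1"
  have s: "\<bar>?s x\<bar> \<le> 1" for x by (auto simp: indicator_def)
  have "l1_dist p q = (\<integral>x. pmf p x * ?s x - pmf q x * ?s x \<partial>count_space UNIV)"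
    unfolding l1_dist_integral by (rule Bochner_Integration.integral_cong) (auto simp: A_def indicator_def)
  also have "\<dots> = measure_pmf.expectation p ?s - measure_pmf.expectation q ?s"
    unfolding expectation_count_space
    by (rule Bochner_Integration.integral_diff; rule integrable_pmf_bounded[OF s])
  also have "\<dots> = 2 * (measure_pmf.prob p A - measure_pmf.prob q A)"
    by (simp add: expectation_signed_indicator)
  finally show ?thesis by (simp add: A_def)
qed

lemma prob_diff_le_l1: "measure_pmf.prob p A - measure_pmf.prob q A \<le> l1_dist p q / 2"
proof -
  let ?s = "\<lambda>x. 2 * indicat_real A x - 1"
  have "measure_pmf.expectation p ?s - measure_pmf.expectation q ?s \<le> l1_dist p q"
    by (rule expectation_diff_le_l1) (auto simp: indicator_def)
  then show ?thesis by (simp add: expectation_signed_indicator)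
qed

lemma l1_dist_self [simp]: "l1_dist p p = 0"
  by (simp add: l1_dist_def)

lemma l1_dist_nonneg: "l1_dist p q \<ge> 0"
  by (simp add: l1_dist_integral)

lemma l1_dist_triangle: "l1_dist p r \<le> l1_dist p q + l1_dist q r"
  using prob_diff_le_l1[of p "{x. pmf r x < pmf p x}" q] prob_diff_le_l1[of q "{x. pmf r x < pmf p x}" r]
  by (subst l1_dist_attained[of p r]) argo

lemma prob_bind_pmf:
  "measure_pmf.prob (bind_pmf p K) A = measure_pmf.expectation p (\<lambda>x. measure_pmf.prob (K x) A)"
proof -
  have "ennreal (measure_pmf.prob (bind_pmf p K) A) = (\<integral>\<^sup>+x. ennreal (measure_pmf.prob (K x) A) \<partial>p)"
    by (simp flip: measure_pmf.emeasure_eq_measure)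
  also have "\<dots> = ennreal (measure_pmf.expectation p (\<lambda>x. measure_pmf.prob (K x) A))"
    by (rule nn_integral_eq_integral) (auto intro!: measure_pmf.integrable_const_bound[where B=1])
  finally show ?thesis by (simp add: integral_nonneg_AE)
qed

lemma l1_dist_bind_le: "l1_dist (bind_pmf p K) (bind_pmf q K) \<le> l1_dist p q"
proof -
  define A where "A = {x. pmf (bind_pmf q K) x < pmf (bind_pmf p K) x}"
  let ?h = "\<lambda>x. measure_pmf.prob (K x) A"
  have i: "integrable (measure_pmf r) ?h" for r
    by (auto intro!: measure_pmf.integrable_const_bound[where B=1])
  \<comment> \<open>Recentring \<open>?h\<close> from [0,1] to [-1,1] yields the factor 2 that
    stands in front of the optimal event.\<close>
  have "measure_pmf.expectation p (\<lambda>x. 2 * ?h x - 1) - measure_pmf.expectation q (\<lambda>x. 2 * ?h x - 1)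
    \<le> l1_dist p q"
    by (rule expectation_diff_le_l1) (auto simp: abs_le_iff)
  then show ?thesis
    by (subst l1_dist_attained) (simp add: prob_bind_pmf i measure_pmf.prob_space flip: A_def)
qed

lemma l1_dist_map_le: "l1_dist (map_pmf f p) (map_pmf f q) \<le> l1_dist p q"
  unfolding map_pmf_def by (rule l1_dist_bind_le)

text \<open>Both sides share the draw from \<open>p\<close>, so they can differ only when it falls
  into \<open>B\<close>. The factor 2 is the one between event probabilities and the l1
  norm.\<close>

lemma l1_dist_bind_kernels_le:
  assumes "\<And>x. x \<in> set_pmf p \<Longrightarrow> x \<notin> B \<Longrightarrow> K x = K' x"
  shows "l1_dist (bind_pmf p K) (bind_pmf p K') \<le> 2 * measure_pmf.prob p B"
proof -
  define A where "A = {x. pmf (bind_pmf p K') x < pmf (bind_pmf p K) x}"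
  have i: "integrable (measure_pmf p) (\<lambda>x. measure_pmf.prob (L x) A)" for L :: "_ \<Rightarrow> 'b pmf"
    by (auto intro!: measure_pmf.integrable_const_bound[where B=1])
  have "measure_pmf.prob (bind_pmf p K) A - measure_pmf.prob (bind_pmf p K') A
     = measure_pmf.expectation p (\<lambda>x. measure_pmf.prob (K x) A - measure_pmf.prob (K' x) A)"
    by (simp add: prob_bind_pmf i)
  also have "\<dots> \<le> measure_pmf.expectation p (indicator B)"
  proof (rule integral_mono_AE)
    show "AE x in p. measure_pmf.prob (K x) A - measure_pmf.prob (K' x) A \<le> indicator B x"
    proof (rule AE_pmfI)
      fix x assume "x \<in> set_pmf p"
      moreover have "measure_pmf.prob (K x) A - measure_pmf.prob (K' x) A \<le> 1"
        using measure_pmf.prob_le_1[of "K x" A] measure_nonneg[of "K' x" A] by linarith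
      ultimately show "measure_pmf.prob (K x) A - measure_pmf.prob (K' x) A \<le> indicator B x"
        using assms by (auto simp: indicator_def)
    qed
    show "integrable (measure_pmf p) (indicat_real B)"
      by (rule measure_pmf.integrable_const_bound[where B=1]) (auto simp: indicator_def)
  qed (auto intro: i)
  finally show ?thesis by (subst l1_dist_attained) (simp flip: A_def)
qed

lemma sum_abs_diff_le_l1:
  assumes "finite E" shows "(\<Sum>x\<in>E. \<bar>pmf p x - pmf q x\<bar>) \<le> l1_dist p q"
proof -
  have i: "integrable (count_space UNIV) (\<lambda>x. \<bar>pmf p x - pmf q x\<bar>)"
    by (intro integrable_abs Bochner_Integration.integrable_diff integrable_pmf)
  have "(\<Sum>x\<in>E. \<bar>pmf p x - pmf q x\<bar>) = (\<integral>x. indicator E x *\<^sub>R \<bar>pmf p x - pmf q x\<bar> \<partial>count_space UNIV)"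
    using assms by (subst lebesgue_integral_count_space_finite_support) 
      (auto simp: indicator_def intro!: sum.mono_neutral_cong_right)
  also have "\<dots> \<le> l1_dist p q" unfolding l1_dist_integral
    by (rule integral_mono[OF _ i]) (use i in \<open>auto simp: indicator_def intro!: Bochner_Integration.integrable_bound[OF i]\<close>)
  finally show ?thesis .
qed

lemma l1_dist_finite_support:
  assumes "finite S" "set_pmf p \<subseteq> S" "set_pmf q \<subseteq> S"
  shows "l1_dist p q = (\<Sum>x\<in>S. \<bar>pmf p x - pmf q x\<bar>)"
proof -
  have "pmf p x = 0" "pmf q x = 0" if "x \<notin> S" for x
    using assms that by (auto simp: pmf_eq_0_set_pmf)
  then have "l1_dist p q = infsum (\<lambda>x. \<bar>pmf p x - pmf q x\<bar>) S"
    unfolding l1_dist_def by (intro infsum_cong_neutral) auto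
  with assms show ?thesis by simp
qed

section \<open>Independent copies\<close>

lemma set_iid_pmf: "set_pmf (iid_pmf n p) = {xs. length xs = n \<and> set xs \<subseteq> set_pmf p}"
  by (induction n) (auto simp: length_Suc_conv)

lemma finite_set_iid_pmf: "finite (set_pmf p) \<Longrightarrow> finite (set_pmf (iid_pmf n p))"
  by (induction n) auto

lemma pmf_iid_pmf: "pmf (iid_pmf n p) xs = (if length xs = n then prod_list (map (pmf p) xs) else 0)"
proof (induction n arbitrary: xs)
  case (Suc n)
  have eq: "iid_pmf (Suc n) p = map_pmf (\<lambda>(x, xs). x # xs) (pair_pmf p (iid_pmf n p))"
    by (simp add: map_pmf_def pair_pmf_def bind_assoc_pmf bind_return_pmf)
  show ?case
  proof (cases xs)
    case Nil
    then show ?thesis by (auto simp: pmf_eq_0_set_pmf)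
  next
    case (Cons y ys)
    have "inj (\<lambda>(x::'a, xs). x # xs)" by (auto simp: inj_def)
    from pmf_map_inj'[OF this, of "pair_pmf p (iid_pmf n p)" "(y, ys)"] show ?thesis
      unfolding eq Cons using Suc by (simp add: pmf_pair)
  qed
qed auto

lemma map_iid_pmf: "map_pmf (map f) (iid_pmf n p) = iid_pmf n (map_pmf f p)"
proof (induction n)
  case (Suc n)
  have "map_pmf (map f) (iid_pmf (Suc n) p)
     = do {x \<leftarrow> p; xs \<leftarrow> map_pmf (map f) (iid_pmf n p); return_pmf (f x # xs)}"
    by (simp add: map_bind_pmf bind_map_pmf)
  then show ?case using Suc by (simp add: bind_map_pmf)
qed simp

primrec list_kernel :: "('a \<Rightarrow> 'b pmf) \<Rightarrow> 'a list \<Rightarrow> 'b list pmf" where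
  "list_kernel K [] = return_pmf []"
| "list_kernel K (x # xs) = do {y \<leftarrow> K x; ys \<leftarrow> list_kernel K xs; return_pmf (y # ys)}"

text \<open>\<open>list_kernel K\<close> is the memoryless channel. Drawing all inputs before any
  output only reorders independent draws.\<close>

lemma iid_pmf_bind: "iid_pmf n (bind_pmf p K) = bind_pmf (iid_pmf n p) (list_kernel K)"
proof (induction n)
  case (Suc n)
  have "iid_pmf (Suc n) (bind_pmf p K)
     = do {x \<leftarrow> p; y \<leftarrow> K x; xs \<leftarrow> iid_pmf n p; ys \<leftarrow> list_kernel K xs; return_pmf (y # ys)}"
    using Suc by (simp add: bind_assoc_pmf)
  also have "\<dots> = do {x \<leftarrow> p; xs \<leftarrow> iid_pmf n p; y \<leftarrow> K x; ys \<leftarrow> list_kernel K xs; return_pmf (y # ys)}"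
    by (subst (2) bind_commute_pmf) rule
  finally show ?case by (simp add: bind_assoc_pmf bind_return_pmf)
qed (simp add: bind_return_pmf)

lemma list_kernel_map: "list_kernel K (map f xs) = list_kernel (\<lambda>x. K (f x)) xs"
  by (induction xs) auto

lemma expectation_bind_finite:
  fixes h :: "'b \<Rightarrow> real"
  assumes "finite (set_pmf p)" "\<And>x. x \<in> set_pmf p \<Longrightarrow> finite (set_pmf (K x))"
  shows "measure_pmf.expectation (bind_pmf p K) h = measure_pmf.expectation p (\<lambda>x. measure_pmf.expectation (K x) h)"
  using assms by (subst pmf_expectation_bind[of "set_pmf p"]) (auto simp: integral_measure_pmf[of "set_pmf p"])

section \<open>Second moments and typical products\<close>

lemma expectation_iid_Suc:
  fixes h :: "'a list \<Rightarrow> real"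
  assumes "finite (set_pmf p)"
  shows "measure_pmf.expectation (iid_pmf (Suc n) p) h
       = measure_pmf.expectation p (\<lambda>x. measure_pmf.expectation (iid_pmf n p) (\<lambda>xs. h (x # xs)))"
  using assms by (simp add: expectation_bind_finite finite_set_iid_pmf)

text \<open>The cross terms vanish because \<open>f\<close> is centred, so the second moment grows
  only linearly and Chebyshev's inequality gains a factor n.\<close>

lemma expectation_iid_sum_list:
  fixes f :: "'a \<Rightarrow> real"
  assumes fin: "finite (set_pmf p)" and mean: "measure_pmf.expectation p f = 0"
  shows "measure_pmf.expectation (iid_pmf n p) (\<lambda>xs. sum_list (map f xs)) = 0"
    and "measure_pmf.expectation (iid_pmf n p) (\<lambda>xs. (sum_list (map f xs))\<^sup>2)
       = n * measure_pmf.expectation p (\<lambda>x. (f x)\<^sup>2)"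
proof (induction n)
  case (Suc n)
  note int = integrable_measure_pmf_finite[OF fin] integrable_measure_pmf_finite[OF finite_set_iid_pmf[OF fin]]
  note simps = expectation_iid_Suc[OF fin] int measure_pmf.prob_space mean
  case 1
  show ?case unfolding expectation_iid_Suc[OF fin] using Suc by (simp add: simps)
  case 2
  show ?case unfolding expectation_iid_Suc[OF fin] using Suc
    by (simp add: simps power2_sum algebra_simps)
qed auto

text \<open>Chebyshev's inequality for the sum of the centred logarithms. As \<open>r\<close> is
  arbitrary, one bound covers the conditional densities of the coding part and both densities of the
  converse.\<close>

lemma aep_upper:
  fixes r :: "'a \<Rightarrow> real"
  assumes fin: "finite (set_pmf p)" and pos: "\<And>x. x \<in> set_pmf p \<Longrightarrow> r x > 0" and "\<delta> > 0" "n > 0"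
    and \<mu>: "\<mu> = measure_pmf.expectation p (\<lambda>x. log 2 (r x))"
  shows "measure_pmf.prob (iid_pmf n p) {xs. prod_list (map r xs) > 2 powr (n * (\<mu> + \<delta>))}
       \<le> measure_pmf.expectation p (\<lambda>x. (log 2 (r x) - \<mu>)\<^sup>2) / (n * \<delta>\<^sup>2)"
proof -
  let ?M = "iid_pmf n p"
  define f where "f x = log 2 (r x) - \<mu>" for x
  define A where "A = {xs. prod_list (map r xs) > 2 powr (n * (\<mu> + \<delta>))}"
  note int = integrable_measure_pmf_finite[OF fin] integrable_measure_pmf_finite[OF finite_set_iid_pmf[OF fin]]
  have mean: "measure_pmf.expectation p f = 0"
    by (simp add: f_def[abs_def] int \<mu> measure_pmf.prob_space)
  have large: "n * \<delta> < sum_list (map f xs)" if "xs \<in> set_pmf ?M" "xs \<in> A" for xs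
  proof -
    have "prod_list (map r xs) > 0 \<and> log 2 (prod_list (map r xs)) = sum_list (map f xs) + length xs * \<mu>"
      if "set xs \<subseteq> set_pmf p" for xs
      using that
    proof (induction xs)
      case (Cons x xs)
      then show ?case using pos[of x] by (simp add: log_mult f_def algebra_simps)
    qed auto
    moreover have "set xs \<subseteq> set_pmf p" "length xs = n" using that by (auto simp: set_iid_pmf)
    ultimately have pr: "prod_list (map r xs) > 0"
      "log 2 (prod_list (map r xs)) = sum_list (map f xs) + n * \<mu>"
      by auto
    from \<open>xs \<in> A\<close> pr(1) have "n * (\<mu> + \<delta>) < log 2 (prod_list (map r xs))"
      by (simp add: A_def less_log_iff)
    with pr(2) show ?thesis by (simp add: algebra_simps)
  qed
  have "(n * \<delta>)\<^sup>2 * measure_pmf.prob ?M A = measure_pmf.expectation ?M (\<lambda>xs. (n * \<delta>)\<^sup>2 * indicator A xs)"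
    by simp
  also have "\<dots> \<le> measure_pmf.expectation ?M (\<lambda>xs. (sum_list (map f xs))\<^sup>2)"
  proof (rule integral_mono_AE)
    show "AE xs in measure_pmf ?M. (real n * \<delta>)\<^sup>2 * indicator A xs \<le> (sum_list (map f xs))\<^sup>2"
      using large \<open>\<delta> > 0\<close> by (intro AE_pmfI) (auto simp: indicator_def intro!: less_imp_le[OF power_strict_mono] mult_nonneg_nonneg)
  qed (auto intro: int)
  also have "\<dots> = n * measure_pmf.expectation p (\<lambda>x. (f x)\<^sup>2)"
    by (rule expectation_iid_sum_list(2)[OF fin mean])
  finally have "measure_pmf.prob ?M A \<le> n * measure_pmf.expectation p (\<lambda>x. (f x)\<^sup>2) / (n * \<delta>)\<^sup>2"
    using assms by (simp add: field_simps)
  also have "\<dots> = measure_pmf.expectation p (\<lambda>x. (f x)\<^sup>2) / (n * \<delta>\<^sup>2)"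
    using \<open>n > 0\<close> by (simp add: power2_eq_square)
  finally show ?thesis by (simp add: A_def f_def)
qed

text \<open>This is the upper tail of 1 / \<open>r\<close>, whose logarithm has the negated mean and
  the same variance.\<close>

lemma aep_lower:
  fixes r :: "'a \<Rightarrow> real"
  assumes fin: "finite (set_pmf p)" and pos: "\<And>x. x \<in> set_pmf p \<Longrightarrow> r x > 0" and "\<delta> > 0" "n > 0"
    and \<mu>: "\<mu> = measure_pmf.expectation p (\<lambda>x. log 2 (r x))"
  shows "measure_pmf.prob (iid_pmf n p) {xs. prod_list (map r xs) < 2 powr (n * (\<mu> - \<delta>))}
       \<le> measure_pmf.expectation p (\<lambda>x. (log 2 (r x) - \<mu>)\<^sup>2) / (n * \<delta>\<^sup>2)"
proof -
  let ?M = "iid_pmf n p"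
  have inv: "prod_list (map (\<lambda>x. inverse (r x)) xs) = inverse (prod_list (map r xs))" for xs
    by (induction xs) auto
  have pr: "prod_list (map r xs) > 0" if "set xs \<subseteq> set_pmf p" for xs
    using that by (induction xs) (auto intro: mult_pos_pos pos)
  have "2 powr (n * (-\<mu> + \<delta>)) < inverse c \<longleftrightarrow> c < 2 powr (n * (\<mu> - \<delta>))" if "c > 0" for c :: real
  proof -
    have "2 powr (n * (-\<mu> + \<delta>)) = inverse (2 powr (n * (\<mu> - \<delta>)))"
      by (simp add: algebra_simps flip: powr_minus)
    with that show ?thesis by (simp add: inverse_less_iff_less)
  qed
  then have "measure_pmf.prob ?M {xs. prod_list (map r xs) < 2 powr (n * (\<mu> - \<delta>))}
    \<le> measure_pmf.prob ?M {xs. prod_list (map (\<lambda>x. inverse (r x)) xs) > 2 powr (n * (-\<mu> + \<delta>))}"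
    by (intro measure_pmf.finite_measure_mono_AE AE_pmfI)
       (auto simp: inv set_iid_pmf pr)
  also have "\<dots> \<le> measure_pmf.expectation p (\<lambda>x. (log 2 (inverse (r x)) - (-\<mu>))\<^sup>2) / (n * \<delta>\<^sup>2)"
    using assms by (intro aep_upper) (auto simp: log_inverse)
  also have "(\<lambda>x. (log 2 (inverse (r x)) - (-\<mu>))\<^sup>2) = (\<lambda>x. (log 2 (r x) - \<mu>)\<^sup>2)"
    by (auto simp: log_inverse power2_commute fun_eq_iff)
  finally show ?thesis .
qed

section \<open>Random binning\<close>

lemma exists_le_expectation:
  fixes h :: "'a \<Rightarrow> real"
  assumes fin: "finite (set_pmf D)" and "measure_pmf.expectation D h \<le> c"
  shows "\<exists>f\<in>set_pmf D. h f \<le> c"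
proof (rule ccontr)
  assume "\<not> ?thesis"
  then have gt: "c < h f" if "f \<in> set_pmf D" for f using that by force
  have "c = (\<Sum>f\<in>set_pmf D. pmf D f * c)"
    using sum_pmf_eq_1[OF fin order.refl] by (simp flip: sum_distrib_right)
  also have "\<dots> < (\<Sum>f\<in>set_pmf D. pmf D f * h f)"
    using gt fin set_pmf_not_empty[of D] by (intro sum_strict_mono) (auto simp: pmf_positive)
  also have "\<dots> = measure_pmf.expectation D h"
    by (subst integral_measure_pmf[OF fin]) auto
  finally show False using assms by simp
qed

text \<open>Only one-point and two-point laws are recorded: collision probabilities and variances
  depend on nothing more.\<close>

lemma random_function:
  fixes S :: "'a set" and T :: "'b set"
  assumes S: "finite S" and T: "finite T" "T \<noteq> {}"
  obtains D :: "('a \<Rightarrow> 'b) pmf" where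
    "finite (set_pmf D)" "\<And>f x. f \<in> set_pmf D \<Longrightarrow> f x \<in> T"
    "\<And>x. x \<in> S \<Longrightarrow> map_pmf (\<lambda>f. f x) D = pmf_of_set T"
    "\<And>x x'. x \<in> S \<Longrightarrow> x' \<in> S \<Longrightarrow> x \<noteq> x' \<Longrightarrow>
       map_pmf (\<lambda>f. (f x, f x')) D = pair_pmf (pmf_of_set T) (pmf_of_set T)"
proof -
  obtain t where t: "t \<in> T" using T by auto
  \<comment> \<open>The default outside \<open>S\<close> is itself an element of \<open>T\<close>,
    so that \<open>f x \<in> T\<close> holds for every \<open>x\<close>.\<close>
  define D where "D = Pi_pmf S t (\<lambda>_. pmf_of_set T)"
  have set: "set_pmf D = PiE_dflt S t (\<lambda>_. T)"
    using assms by (simp add: D_def set_Pi_pmf o_def)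
  show ?thesis
  proof
    show "finite (set_pmf D)" using assms by (auto simp: set)
    show "f x \<in> T" if "f \<in> set_pmf D" for f x
      using that t by (cases "x \<in> S") (auto simp: set PiE_dflt_def)
    show "map_pmf (\<lambda>f. f x) D = pmf_of_set T" if "x \<in> S" for x
      using that S by (simp add: D_def Pi_pmf_component)
    show "map_pmf (\<lambda>f. (f x, f x')) D = pair_pmf (pmf_of_set T) (pmf_of_set T)"
      if x: "x \<in> S" "x' \<in> S" "x \<noteq> x'" for x x'
    proof -
      have "S = insert x (S - {x})" using x by auto
      then have "D = Pi_pmf (insert x (S - {x})) t (\<lambda>_. pmf_of_set T)"
        by (simp add: D_def)
      also have "\<dots> = map_pmf (\<lambda>(y, f). f(x := y)) (pair_pmf (pmf_of_set T) (Pi_pmf (S - {x}) t (\<lambda>_. pmf_of_set T)))"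
        using S by (subst Pi_pmf_insert) auto
      finally have "map_pmf (\<lambda>f. (f x, f x')) D
        = map_pmf (\<lambda>(y, f). (y, f x')) (pair_pmf (pmf_of_set T) (Pi_pmf (S - {x}) t (\<lambda>_. pmf_of_set T)))"
        using x by (simp add: map_pmf_comp case_prod_unfold)
      also have "\<dots> = pair_pmf (map_pmf (\<lambda>y. y) (pmf_of_set T))
           (map_pmf (\<lambda>f. f x') (Pi_pmf (S - {x}) t (\<lambda>_. pmf_of_set T)))"
        by (rule map_pair)
      finally show ?thesis using x S by (simp add: Pi_pmf_component)
    qed
  qed
qed

section \<open>Compression with side information\<close>

lemma prob_finite_sum:
  assumes "finite (set_pmf p)"
  shows "measure_pmf.prob p A = (\<Sum>x\<in>set_pmf p. pmf p x * indicator A x)"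
proof -
  have "measure_pmf.prob p A = measure_pmf.expectation p (indicator A)" by simp
  then show ?thesis using assms by (subst (asm) integral_measure_pmf[of "set_pmf p"]) auto
qed

lemma sum_pmf_le_marginal:
  assumes "finite F" shows "(\<Sum>x\<in>F. pmf p (x, y)) \<le> pmf (map_pmf snd p) y"
proof -
  have "(\<Sum>x\<in>F. pmf p (x, y)) = (\<Sum>w\<in>(\<lambda>x. (x, y)) ` F. pmf p w)"
    by (subst sum.reindex) (auto simp: inj_on_def)
  also have "\<dots> = measure_pmf.prob p ((\<lambda>x. (x, y)) ` F)"
    using assms by (simp add: measure_measure_pmf_finite)
  also have "\<dots> \<le> measure_pmf.prob p (snd -` {y})"
    by (rule measure_pmf.finite_measure_mono) auto
  finally show ?thesis by (simp add: pmf_map)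
qed

lemma sum_pmf_eq_marginal:
  assumes "finite F" "fst ` set_pmf p \<subseteq> F" shows "(\<Sum>x\<in>F. pmf p (x, y)) = pmf (map_pmf snd p) y"
proof -
  have "(\<Sum>x\<in>F. pmf p (x, y)) = (\<Sum>w\<in>(\<lambda>x. (x, y)) ` F. pmf p w)"
    by (subst sum.reindex) (auto simp: inj_on_def)
  also have "\<dots> = measure_pmf.prob p ((\<lambda>x. (x, y)) ` F)"
    using assms by (simp add: measure_measure_pmf_finite)
  also have "\<dots> = measure_pmf.prob p (snd -` {y})"
    using assms by (intro measure_pmf.finite_measure_eq_AE AE_pmfI) force+
  finally show ?thesis by (simp add: pmf_map)
qed

text \<open>The decoder picks any candidate in the announced bin, a candidate being an
  \<open>x\<close> of conditional probability at least \<theta> given \<open>y\<close>. There are at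
  most 1 / \<theta> of them, and each wrong one shares the bin of the true \<open>x\<close> with
  probability \<open>1 / card T\<close>. So decoding fails only if the true pair is atypical or if a
  competitor collides.\<close>

lemma slepian_wolf_one_shot:
  fixes p :: "('a \<times> 'b) pmf" and T :: "'c set" and \<theta> :: real
  assumes fin: "finite (set_pmf p)" and T: "finite T" "T \<noteq> {}" and \<theta>: "\<theta> > 0"
  obtains f d where "\<And>x. f x \<in> T"
    "measure_pmf.prob p {(x, y). d (f x) y \<noteq> x}
     \<le> measure_pmf.prob p {(x, y). pmf p (x, y) < \<theta> * pmf (map_pmf snd p) y} + 1 / (\<theta> * card T)"
proof -
  define S where "S = fst ` set_pmf p"
  have S: "finite S" using fin by (simp add: S_def)
  obtain D :: "('a \<Rightarrow> 'c) pmf" where D: "finite (set_pmf D)" "\<And>f x. f \<in> set_pmf D \<Longrightarrow> f x \<in> T"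
    "\<And>x. x \<in> S \<Longrightarrow> map_pmf (\<lambda>f. f x) D = pmf_of_set T"
    "\<And>x x'. x \<in> S \<Longrightarrow> x' \<in> S \<Longrightarrow> x \<noteq> x' \<Longrightarrow>
       map_pmf (\<lambda>f. (f x, f x')) D = pair_pmf (pmf_of_set T) (pmf_of_set T)"
    by (rule random_function[OF S T]; rule that; assumption)
  define B where "B = {(x, y). pmf p (x, y) < \<theta> * pmf (map_pmf snd p) y}"
  define G where "G y = {x \<in> S. (x, y) \<in> set_pmf p \<and> (x, y) \<notin> B}" for y
  define d where "d f c y = (SOME x. x \<in> G y \<and> f x = c)" for f :: "'a \<Rightarrow> 'c" and c y
  have finG: "finite (G y)" for y using S by (simp add: G_def)
  have card_G: "card (G y) \<le> 1 / \<theta>" for y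
  proof (cases "G y = {}")
    case False
    then obtain x where "x \<in> G y" by auto
    then have pos: "pmf (map_pmf snd p) y > 0" by (force simp: G_def pmf_positive_iff)
    have "card (G y) * (\<theta> * pmf (map_pmf snd p) y) = (\<Sum>x\<in>G y. \<theta> * pmf (map_pmf snd p) y)" by simp
    also have "\<dots> \<le> (\<Sum>x\<in>G y. pmf p (x, y))"
      by (rule sum_mono) (auto simp: G_def B_def)
    also have "\<dots> \<le> pmf (map_pmf snd p) y" by (rule sum_pmf_le_marginal[OF finG])
    finally show ?thesis using pos \<theta> by (simp add: field_simps)
  qed (use \<theta> in simp)
  \<comment> \<open>The mean number of competitors in the bin of the true \<open>x\<close>. It
    dominates the probability of a wrong choice and is linear in the collision indicators, hence
    easy to average over \<open>f\<close>.\<close>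
  let ?coll = "\<lambda>f. \<Sum>(x, y)\<in>set_pmf p. pmf p (x, y) * (\<Sum>x'\<in>G y - {x}. indicat_real {f. f x = f x'} f)"
  have err: "measure_pmf.prob p {(x, y). d f (f x) y \<noteq> x} \<le> measure_pmf.prob p B + ?coll f" for f
  proof -
    have "indicat_real {(x, y). d f (f x) y \<noteq> x} w
       \<le> indicator B w + (case w of (x, y) \<Rightarrow> \<Sum>x'\<in>G y - {x}. indicat_real {f. f x = f x'} f)"
      if "w \<in> set_pmf p" for w
    proof -
      obtain x y where w: "w = (x, y)" by (cases w)
      let ?s = "\<Sum>x'\<in>G y - {x}. indicat_real {f. f x = f x'} f"
      have "?s \<ge> 0" by (intro sum_nonneg) auto
      moreover have "?s \<ge> 1" if "w \<notin> B" "d f (f x) y \<noteq> x"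
      proof -
        have "x \<in> G y" using that \<open>w \<in> set_pmf p\<close> by (force simp: G_def S_def w)
        then have "d f (f x) y \<in> G y \<and> f (d f (f x) y) = f x"
          unfolding d_def by (rule_tac someI[of "\<lambda>x'. x' \<in> G y \<and> f x' = f x" x]) auto
        then have x': "d f (f x) y \<in> G y - {x}" "f (d f (f x) y) = f x" using that by auto
        then have "1 = (\<Sum>x'\<in>{d f (f x) y}. indicat_real {f. f x = f x'} f)" by (simp add: indicator_def)
        also have "\<dots> \<le> ?s" by (rule sum_mono2) (use x' finG in auto)
        finally show ?thesis .
      qed
      ultimately show ?thesis by (auto simp: w indicator_def)
    qed
    then show ?thesis
      by (subst (1 2) prob_finite_sum[OF fin])
         (auto simp: case_prod_beta simp flip: sum.distrib distrib_left intro!: sum_mono mult_left_mono)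
  qed
  have coll: "measure_pmf.prob D {f. f x = f x'} = 1 / card T" if "x \<in> S" "x' \<in> S" "x \<noteq> x'" for x x'
  proof -
    have "measure_pmf.prob D {f. f x = f x'} = measure_pmf.prob (map_pmf (\<lambda>f. (f x, f x')) D) {(a, b). a = b}"
      by (simp add: vimage_def)
    also have "\<dots> = measure_pmf.prob (pair_pmf (pmf_of_set T) (pmf_of_set T)) ((\<lambda>a. (a, a)) ` T)"
      unfolding D(4)[OF that] using T by (intro measure_pmf.finite_measure_eq_AE AE_pmfI) auto
    also have "\<dots> = (\<Sum>a\<in>T. 1 / card T * (1 / card T))"
      using T by (simp add: measure_measure_pmf_finite sum.reindex inj_on_def pmf_pair)
    finally show ?thesis using T by simp
  qed
  have "measure_pmf.expectation D (\<lambda>f. measure_pmf.prob p B + ?coll f)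
     = measure_pmf.prob p B + (\<Sum>(x, y)\<in>set_pmf p. pmf p (x, y) * (\<Sum>x'\<in>G y - {x}. measure_pmf.prob D {f. f x = f x'}))"
    using D(1) by (simp add: integrable_measure_pmf_finite case_prod_beta measure_pmf.prob_space)
  also have "(\<Sum>(x, y)\<in>set_pmf p. pmf p (x, y) * (\<Sum>x'\<in>G y - {x}. measure_pmf.prob D {f. f x = f x'}))
     \<le> (\<Sum>(x, y)\<in>set_pmf p. pmf p (x, y) * (1 / (\<theta> * card T)))"
  proof (rule sum_mono, clarify, rule mult_left_mono)
    fix x y assume "(x, y) \<in> set_pmf p"
    then have "(\<Sum>x'\<in>G y - {x}. measure_pmf.prob D {f. f x = f x'}) = (\<Sum>x'\<in>G y - {x}. 1 / card T)"
      by (intro sum.cong refl coll) (force simp: G_def S_def)+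
    also have "\<dots> \<le> (\<Sum>x'\<in>G y. 1 / card T)" by (rule sum_mono2) (use finG in auto)
    also have "\<dots> = card (G y) * (1 / card T)" by simp
    also have "\<dots> \<le> 1 / \<theta> * (1 / card T)" by (rule mult_right_mono[OF card_G]) simp
    finally show "(\<Sum>x'\<in>G y - {x}. measure_pmf.prob D {f. f x = f x'}) \<le> 1 / (\<theta> * card T)" by simp
  qed auto
  also have "\<dots> = 1 / (\<theta> * card T)"
    using sum_pmf_eq_1[OF fin order.refl] by (simp add: case_prod_beta flip: sum_distrib_right sum_divide_distrib)
  finally obtain f where "f \<in> set_pmf D" "measure_pmf.prob p B + ?coll f \<le> measure_pmf.prob p B + 1 / (\<theta> * card T)"
    using exists_le_expectation[OF D(1)] by force
  with err[of f] D(2)[of f] that[of f "d f"] show ?thesis by (force simp: B_def)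
qed

section \<open>Leftover hashing\<close>

lemma random_function_covariance:
  assumes fin: "finite (set_pmf D)" and T: "finite T" "T \<noteq> {}" "u \<in> T"
    and single: "map_pmf (\<lambda>f. f x) D = pmf_of_set T" "map_pmf (\<lambda>f. f x') D = pmf_of_set T"
    and pair: "x \<noteq> x' \<Longrightarrow> map_pmf (\<lambda>f. (f x, f x')) D = pair_pmf (pmf_of_set T) (pmf_of_set T)"
  defines "c \<equiv> \<lambda>x f. indicat_real {f. f x = u} f - 1 / card T"
  shows "measure_pmf.expectation D (\<lambda>f. c x f * c x' f) \<le> (if x = x' then 1 / card T else 0)"
proof -
  note int = integrable_measure_pmf_finite[OF fin]
  have prob: "measure_pmf.prob D {f. f y = u} = 1 / card T" if "map_pmf (\<lambda>f. f y) D = pmf_of_set T" for y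
  proof -
    have "measure_pmf.prob D {f. f y = u} = pmf (map_pmf (\<lambda>f. f y) D) u"
      by (simp add: pmf_map vimage_def)
    then show ?thesis using that T by simp
  qed
  have "c x f * c x' f = indicat_real {f. f x = u \<and> f x' = u} f - indicat_real {f. f x = u} f / card T
      - indicat_real {f. f x' = u} f / card T + 1 / (card T)\<^sup>2" for f
    by (auto simp: c_def indicator_def algebra_simps power2_eq_square)
  then have "measure_pmf.expectation D (\<lambda>f. c x f * c x' f)
     = measure_pmf.prob D {f. f x = u \<and> f x' = u} - 1 / (card T)\<^sup>2"
    using prob[OF single(1)] prob[OF single(2)]
    by (simp add: int measure_pmf.prob_space power2_eq_square)
  \<comment> \<open>On the diagonal the variance of an indicator is at most its mean. Off the
    diagonal pairwise independence makes the covariance vanish.\<close>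
  also have "\<dots> \<le> (if x = x' then 1 / card T else 0)"
  proof (cases "x = x'")
    case True
    then show ?thesis using prob[OF single(1)] by simp
  next
    case False
    have "measure_pmf.prob D {f. f x = u \<and> f x' = u} = pmf (map_pmf (\<lambda>f. (f x, f x')) D) (u, u)"
      by (simp add: pmf_map vimage_def)
    also have "\<dots> = 1 / (card T)\<^sup>2" unfolding pair[OF False] using T by (simp add: pmf_pair power2_eq_square)
    finally show ?thesis using False by simp
  qed
  finally show ?thesis .
qed

text \<open>A leftover hash bound with smoothing. For conditional probabilities at most \<theta>,
  the mean deviation of each bin from uniform is at most sqrt (\<theta> / N) relative to the weight
  of \<open>z\<close>, where N is the number of bins. Summing over the bins gives N * sqrt (\<theta>
  / N) = sqrt (N * \<theta>). Pairs above the threshold are charged in full.\<close>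

lemma privacy_amplification_one_shot:
  fixes p :: "('a \<times> 'b) pmf" and T :: "'c set" and \<theta> :: real
  assumes fin: "finite (set_pmf p)" and T: "finite T" "T \<noteq> {}" and \<theta>: "\<theta> > 0"
  obtains g where "\<And>x. g x \<in> T"
    "l1_dist (map_pmf (\<lambda>(x, z). (g x, z)) p) (pair_pmf (pmf_of_set T) (map_pmf snd p))
     \<le> 2 * measure_pmf.prob p {(x, z). pmf p (x, z) > \<theta> * pmf (map_pmf snd p) z} + sqrt (card T * \<theta>)"
proof -
  define S where "S = fst ` set_pmf p"
  define R where "R = snd ` set_pmf p"
  have S: "finite S" and R: "finite R" using fin by (simp_all add: S_def R_def)
  obtain D :: "('a \<Rightarrow> 'c) pmf" where D: "finite (set_pmf D)" "\<And>f x. f \<in> set_pmf D \<Longrightarrow> f x \<in> T"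
    "\<And>x. x \<in> S \<Longrightarrow> map_pmf (\<lambda>f. f x) D = pmf_of_set T"
    "\<And>x x'. x \<in> S \<Longrightarrow> x' \<in> S \<Longrightarrow> x \<noteq> x' \<Longrightarrow>
       map_pmf (\<lambda>f. (f x, f x')) D = pair_pmf (pmf_of_set T) (pmf_of_set T)"
    by (rule random_function[OF S T]; rule that; assumption)
  note int = integrable_measure_pmf_finite[OF D(1)]
  define N where "N = real (card T)"
  have N: "N > 0" using T by (simp add: N_def card_gt_0_iff)
  define B where "B = {(x, z). pmf p (x, z) > \<theta> * pmf (map_pmf snd p) z}"
  define P where "P z = pmf (map_pmf snd p) z" for z
  have P_pos: "P z > 0" if "z \<in> R" for z using that by (auto simp: P_def R_def pmf_positive_iff)
  have sum_P: "(\<Sum>z\<in>R. P z) = 1" unfolding P_def using R by (intro sum_pmf_eq_1) (auto simp: R_def)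
  \<comment> \<open>\<open>p1\<close> is the flat part, to which the variance bound applies.
    \<open>p2\<close> carries the atypical mass and is bounded trivially.\<close>
  define p1 where "p1 x z = (if (x, z) \<in> B then 0 else pmf p (x, z))" for x z
  define p2 where "p2 x z = (if (x, z) \<in> B then pmf p (x, z) else 0)" for x z
  have p12: "pmf p (x, z) = p1 x z + p2 x z" for x z by (simp add: p1_def p2_def)
  have p1_le: "0 \<le> p1 x z" "p1 x z \<le> \<theta> * P z" for x z
    using \<theta> by (auto simp: p1_def P_def B_def)
  have marg: "(\<Sum>x\<in>S. pmf p (x, z)) = P z" for z
    unfolding P_def using S by (rule sum_pmf_eq_marginal) (simp add: S_def)
  have "(\<Sum>x\<in>S. p1 x z) \<le> P z" for z
    unfolding marg[symmetric] by (rule sum_mono) (simp add: p1_def)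
  \<comment> \<open>Subtracting 1 / N removes the product law, so that sums weighted with
    \<open>c\<close> are exactly the differences inside the l1 distance.\<close>
  define c where "c u x f = indicat_real {f. f x = u} f - 1 / N" for u x and f :: "'a \<Rightarrow> 'c"
  let ?A = "\<lambda>f z u. \<bar>\<Sum>x\<in>S. p1 x z * c u x f\<bar>"
  have bound: "l1_dist (map_pmf (\<lambda>(x, z). (g x, z)) p) (pair_pmf (pmf_of_set T) (map_pmf snd p))
     \<le> 2 * measure_pmf.prob p B + (\<Sum>z\<in>R. \<Sum>u\<in>T. ?A g z u)" if g: "g \<in> set_pmf D" for g
  proof -
    have pm: "pmf (map_pmf (\<lambda>(x, z). (g x, z)) p) (u, z) = (\<Sum>x\<in>S. pmf p (x, z) * indicat_real {f. f x = u} g)" for u z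
    proof -
      have "pmf (map_pmf (\<lambda>(x, z). (g x, z)) p) (u, z) = measure_pmf.prob p ((\<lambda>x. (x, z)) ` {x\<in>S. g x = u})"
        unfolding pmf_map by (intro measure_pmf.finite_measure_eq_AE AE_pmfI) (force simp: S_def)+
      also have "\<dots> = (\<Sum>x\<in>{x\<in>S. g x = u}. pmf p (x, z))"
        using S by (simp add: measure_measure_pmf_finite sum.reindex inj_on_def)
      finally show ?thesis using S by (auto simp: indicator_def sum.If_cases Int_def if_distrib cong: if_cong)
    qed
    have diff: "pmf (map_pmf (\<lambda>(x, z). (g x, z)) p) (u, z) - pmf (pair_pmf (pmf_of_set T) (map_pmf snd p)) (u, z)
       = (\<Sum>x\<in>S. p1 x z * c u x g) + (\<Sum>x\<in>S. p2 x z * c u x g)" if "u \<in> T" for u z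
      using T that marg[of z, symmetric]
      by (simp add: pm pmf_pair N_def[symmetric] P_def[symmetric] p12 c_def sum_subtractf sum.distrib algebra_simps sum_distrib_left sum_divide_distrib add_divide_distrib)
    \<comment> \<open>One unit comes from the bin that contains \<open>x\<close>, the other from the
      N uniform weights 1 / N.\<close>
    have sumc: "(\<Sum>u\<in>T. \<bar>c u x g\<bar>) \<le> 2" for x
    proof -
      have "(\<Sum>u\<in>T. \<bar>c u x g\<bar>) \<le> (\<Sum>u\<in>T. indicat_real {g x} u + 1 / N)"
        using N by (intro sum_mono) (auto simp: c_def indicator_def abs_le_iff)
      also have "\<dots> = 2" using D(2)[OF g, of x] T N
        by (simp add: sum.distrib N_def indicator_def sum.delta)
      finally show ?thesis .
    qed
    have sumB: "(\<Sum>z\<in>R. \<Sum>x\<in>S. p2 x z) = measure_pmf.prob p B"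
    proof -
      have "measure_pmf.prob p B = measure_pmf.prob p (B \<inter> S \<times> R)"
        by (intro measure_pmf.finite_measure_eq_AE AE_pmfI) (force simp: S_def R_def)+
      also have "\<dots> = (\<Sum>w\<in>S \<times> R. if w \<in> B then pmf p w else 0)"
        using S R by (simp add: measure_measure_pmf_finite sum.inter_restrict[symmetric] Int_commute)
      also have "\<dots> = (\<Sum>z\<in>R. \<Sum>x\<in>S. p2 x z)"
        by (subst sum.swap) (auto simp: sum.cartesian_product p2_def intro!: sum.cong)
      finally show ?thesis ..
    qed
    have "l1_dist (map_pmf (\<lambda>(x, z). (g x, z)) p) (pair_pmf (pmf_of_set T) (map_pmf snd p))
      = (\<Sum>(u, z)\<in>T \<times> R. \<bar>pmf (map_pmf (\<lambda>(x, z). (g x, z)) p) (u, z) - pmf (pair_pmf (pmf_of_set T) (map_pmf snd p)) (u, z)\<bar>)"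
      using T R D(2)[OF g] by (subst l1_dist_finite_support[of "T \<times> R"]) (force simp: R_def case_prod_beta)+
    also have "\<dots> = (\<Sum>z\<in>R. \<Sum>u\<in>T. \<bar>(\<Sum>x\<in>S. p1 x z * c u x g) + (\<Sum>x\<in>S. p2 x z * c u x g)\<bar>)"
      unfolding sum.cartesian_product[symmetric] by (subst sum.swap) (simp add: diff)
    also have "\<dots> \<le> (\<Sum>z\<in>R. \<Sum>u\<in>T. ?A g z u + (\<Sum>x\<in>S. p2 x z * \<bar>c u x g\<bar>))"
    proof (intro sum_mono)
      fix z u
      have "\<bar>\<Sum>x\<in>S. p2 x z * c u x g\<bar> \<le> (\<Sum>x\<in>S. p2 x z * \<bar>c u x g\<bar>)"
        by (rule order.trans[OF sum_abs]) (auto simp: abs_mult p2_def intro!: sum_mono)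
      then show "\<bar>(\<Sum>x\<in>S. p1 x z * c u x g) + (\<Sum>x\<in>S. p2 x z * c u x g)\<bar>
         \<le> ?A g z u + (\<Sum>x\<in>S. p2 x z * \<bar>c u x g\<bar>)" by linarith
    qed
    also have "\<dots> = (\<Sum>z\<in>R. \<Sum>u\<in>T. ?A g z u) + (\<Sum>z\<in>R. \<Sum>x\<in>S. p2 x z * (\<Sum>u\<in>T. \<bar>c u x g\<bar>))"
      by (simp add: sum.distrib sum_distrib_left sum.swap[of _ T S])
    also have "(\<Sum>z\<in>R. \<Sum>x\<in>S. p2 x z * (\<Sum>u\<in>T. \<bar>c u x g\<bar>)) \<le> (\<Sum>z\<in>R. \<Sum>x\<in>S. p2 x z * 2)"
      by (intro sum_mono mult_left_mono sumc) (simp add: p2_def)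
    also have "\<dots> = 2 * measure_pmf.prob p B"
      by (simp add: sumB flip: sum_distrib_right)
    finally show ?thesis by linarith
  qed
  have second_moment: "measure_pmf.expectation D (\<lambda>f. (\<Sum>x\<in>S. p1 x z * c u x f)\<^sup>2) \<le> \<theta> * (P z)\<^sup>2 / N"
    if "u \<in> T" for z u
  proof -
    have "measure_pmf.expectation D (\<lambda>f. (\<Sum>x\<in>S. p1 x z * c u x f)\<^sup>2)
      = (\<Sum>x\<in>S. \<Sum>x'\<in>S. p1 x z * p1 x' z * measure_pmf.expectation D (\<lambda>f. c u x f * c u x' f))"
      by (simp add: power2_eq_square sum_product int mult_ac)
    also have "\<dots> \<le> (\<Sum>x\<in>S. \<Sum>x'\<in>S. p1 x z * p1 x' z * (if x = x' then 1 / N else 0))"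
    proof (intro sum_mono mult_left_mono)
      fix x x' assume "x \<in> S" "x' \<in> S"
      then show "measure_pmf.expectation D (\<lambda>f. c u x f * c u x' f) \<le> (if x = x' then 1 / N else 0)"
        unfolding c_def N_def using D T that by (intro random_function_covariance) auto
    qed (simp add: p1_le)
    also have "\<dots> = (\<Sum>x\<in>S. p1 x z * p1 x z / N)"
      using S by (simp add: if_distrib cong: if_cong)
    also have "\<dots> \<le> (\<Sum>x\<in>S. \<theta> * P z * p1 x z / N)"
      using N by (intro sum_mono divide_right_mono mult_right_mono p1_le) auto
    also have "\<dots> = \<theta> * P z / N * (\<Sum>x\<in>S. p1 x z)" by (simp add: sum_distrib_left)
    also have "\<dots> \<le> \<theta> * P z / N * P z"
      using \<open>(\<Sum>x\<in>S. p1 x z) \<le> P z\<close> N \<theta> by (intro mult_left_mono) (auto simp: P_def)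
    finally show ?thesis by (simp add: power2_eq_square)
  qed
  have first_moment: "measure_pmf.expectation D (\<lambda>f. ?A f z u) \<le> P z * sqrt (\<theta> / N)"
    if "u \<in> T" "z \<in> R" for z u
  proof -
    \<comment> \<open>\<open>a\<close> is the bound on the root mean square. The inequality
      \<open>\<bar>w\<bar> \<le> w\<^sup>2 / (2 * a) + a / 2\<close> replaces Jensen's inequality
      and returns \<open>a\<close> itself; \<open>z \<in> R\<close> keeps \<open>a\<close>
      positive.\<close>
    define a where "a = P z * sqrt (\<theta> / N)"
    have a: "a > 0" using P_pos[OF that(2)] \<theta> N by (simp add: a_def)
    have a2: "a\<^sup>2 = \<theta> * (P z)\<^sup>2 / N" using \<theta> N by (simp add: a_def power_mult_distrib)
    have "\<bar>w\<bar> \<le> w\<^sup>2 / (2 * a) + a / 2" for w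
    proof -
      have "2 * a * \<bar>w\<bar> \<le> w\<^sup>2 + a\<^sup>2" using zero_le_power2[of "\<bar>w\<bar> - a"] by (simp add: power2_diff mult_ac)
      then have "\<bar>w\<bar> \<le> (w\<^sup>2 + a\<^sup>2) / (2 * a)" using a by (simp add: field_simps)
      then show ?thesis using a by (simp add: add_divide_distrib power2_eq_square)
    qed
    then have "measure_pmf.expectation D (\<lambda>f. ?A f z u)
       \<le> measure_pmf.expectation D (\<lambda>f. (\<Sum>x\<in>S. p1 x z * c u x f)\<^sup>2 / (2 * a) + a / 2)"
      by (intro integral_mono int)
    also have "\<dots> = measure_pmf.expectation D (\<lambda>f. (\<Sum>x\<in>S. p1 x z * c u x f)\<^sup>2) / (2 * a) + a / 2"
      by (simp add: int measure_pmf.prob_space)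
    also have "\<dots> \<le> a\<^sup>2 / (2 * a) + a / 2"
      using second_moment[OF that(1)] a by (intro add_right_mono divide_right_mono) (auto simp: a2)
    also have "\<dots> = a" using a by (simp add: power2_eq_square)
    finally show ?thesis by (simp add: a_def)
  qed
  have "measure_pmf.expectation D (\<lambda>g. 2 * measure_pmf.prob p B + (\<Sum>z\<in>R. \<Sum>u\<in>T. ?A g z u))
     = 2 * measure_pmf.prob p B + (\<Sum>z\<in>R. \<Sum>u\<in>T. measure_pmf.expectation D (\<lambda>g. ?A g z u))"
    by (simp add: int measure_pmf.prob_space)
  also have "\<dots> \<le> 2 * measure_pmf.prob p B + (\<Sum>z\<in>R. \<Sum>u\<in>T. P z * sqrt (\<theta> / N))"
    by (intro add_left_mono sum_mono first_moment)
  also have "(\<Sum>z\<in>R. \<Sum>u\<in>T. P z * sqrt (\<theta> / N)) = N * sqrt (\<theta> / N)"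
    using sum_P by (simp add: N_def flip: sum_distrib_left sum_distrib_right)
  also have "N * sqrt (\<theta> / N) = sqrt (N * \<theta>)"
    using N by (simp add: real_sqrt_divide real_sqrt_mult field_simps)
  finally obtain g where g: "g \<in> set_pmf D" and
    "2 * measure_pmf.prob p B + (\<Sum>z\<in>R. \<Sum>u\<in>T. ?A g z u) \<le> 2 * measure_pmf.prob p B + sqrt (N * \<theta>)"
    using exists_le_expectation[OF D(1)] by force
  with bound[OF g] D(2)[OF g] that[of g] show ?thesis by (force simp: B_def N_def)
qed

section \<open>Common randomness from public discussion\<close>

lemma prob_le_of_pmf_le:
  assumes "\<And>x. x \<in> X \<Longrightarrow> pmf p x \<le> M * pmf q x"
  shows "measure_pmf.prob p X \<le> M * measure_pmf.prob q X"
proof -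
  have "(\<integral>x. pmf p x \<partial>count_space X) \<le> (\<integral>x. M * pmf q x \<partial>count_space X)"
    using assms by (intro integral_mono integrable_pmf integrable_mult_right) auto
  then show ?thesis by (simp add: integral_pmf)
qed

lemma prob_pair_pmf_Times:
  "measure_pmf.prob (pair_pmf p q) (A \<times> B) = measure_pmf.prob p A * measure_pmf.prob q B"
proof -
  \<comment> \<open>Restricting to the supports makes both factors countable.\<close>
  have "measure_pmf.prob (pair_pmf p q) (A \<times> B)
     = measure_pmf.prob (pair_pmf p q) ((A \<inter> set_pmf p) \<times> (B \<inter> set_pmf q))"
    by (intro measure_pmf.finite_measure_eq_AE AE_pmfI) auto
  also have "\<dots> = measure_pmf.prob p (A \<inter> set_pmf p) * measure_pmf.prob q (B \<inter> set_pmf q)"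
    by (rule measure_pmf_prob_product) (auto intro: countable_subset[OF _ countable_set_pmf])
  finally show ?thesis by (simp add: measure_Int_set_pmf)
qed

text \<open>Transcripts range over an infinite set. Cutting their law down to a finite set at cost
  \<eta> keeps the converse within finite sums.\<close>

lemma pmf_finite_approx:
  assumes "\<eta> > 0"
  obtains F where "finite F" "(\<Sum>x\<in>F. pmf q x) > 1 - \<eta>"
proof -
  have s: "Infinite_Set_Sum.abs_summable_on (pmf q) UNIV" by (rule pmf_abs_summable)
  then have "(\<lambda>x. norm (pmf q x)) summable_on UNIV"
    using abs_summable_equivalent by blast
  then have "pmf q summable_on UNIV" by (rule abs_summable_summable)
  moreover have "infsum (pmf q) UNIV = 1"
    using infsetsum_infsum[OF s] by (simp add: infsetsum_pmf_eq_1)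
  ultimately have "(sum (pmf q) \<longlongrightarrow> 1) (finite_subsets_at_top UNIV)"
    by (metis has_sum_def has_sum_infsum)
  then have "\<forall>\<^sub>F F in finite_subsets_at_top UNIV. sum (pmf q) F > 1 - \<eta>"
    using assms by (intro order_tendstoD) auto
  then show ?thesis using that by (auto simp: eventually_finite_subsets_at_top)
qed

lemma sum_sqrt_mult_le:
  fixes a b :: "'i \<Rightarrow> real"
  assumes "\<And>i. i \<in> I \<Longrightarrow> a i \<ge> 0" "\<And>i. i \<in> I \<Longrightarrow> b i \<ge> 0"
  shows "(\<Sum>i\<in>I. sqrt (a i * b i)) \<le> sqrt ((\<Sum>i\<in>I. a i) * (\<Sum>i\<in>I. b i))"
proof (rule real_le_rsqrt)
  have "(\<Sum>i\<in>I. sqrt (a i) * sqrt (b i))\<^sup>2 \<le> (\<Sum>i\<in>I. (sqrt (a i))\<^sup>2) * (\<Sum>i\<in>I. (sqrt (b i))\<^sup>2)"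
    by (rule Cauchy_Schwarz_ineq_sum)
  then show "(\<Sum>i\<in>I. sqrt (a i * b i))\<^sup>2 \<le> (\<Sum>i\<in>I. a i) * (\<Sum>i\<in>I. b i)"
    using assms by (simp add: real_sqrt_mult)
qed

lemma sum_prob_disjoint_le:
  assumes "finite I" "\<And>i j x. i \<in> I \<Longrightarrow> j \<in> I \<Longrightarrow> x \<in> E i \<Longrightarrow> x \<in> E j \<Longrightarrow> i = j" "\<And>i. i \<in> I \<Longrightarrow> E i \<subseteq> B"
  shows "(\<Sum>i\<in>I. measure_pmf.prob p (E i)) \<le> measure_pmf.prob p B"
proof -
  have "(\<Sum>i\<in>I. measure_pmf.prob p (E i)) = measure_pmf.prob p (\<Union>i\<in>I. E i)"
    by (rule measure_pmf.finite_measure_finite_Union[symmetric])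
       (use assms in \<open>auto simp: disjoint_family_on_def\<close>)
  also have "\<dots> \<le> measure_pmf.prob p B"
    using assms(3) by (intro measure_pmf.finite_measure_mono) auto
  finally show ?thesis .
qed

text \<open>The predicates \<open>okA\<close> and \<open>okB\<close> cut out, for each transcript, the rectangle of
  inputs compatible with it.  The right-hand side \<open>sqrt (M * c)\<close> needs no union bound over the
  transcripts because the rectangles are disjoint.\<close>

lemma common_randomness_converse:
  fixes S :: "('a \<times> 'b) pmf" and p :: "'w pmf" and Q :: "'t pmf"
  assumes ok: "\<And>\<alpha> \<beta>. (\<alpha>, \<beta>) \<in> set_pmf S \<Longrightarrow> okA (tr \<alpha> \<beta>) \<alpha> \<and> okB (tr \<alpha> \<beta>) \<beta>"
    and unique: "\<And>\<tau> \<tau>' \<alpha> \<beta>. okA \<tau> \<alpha> \<Longrightarrow> okB \<tau> \<beta> \<Longrightarrow> okA \<tau>' \<alpha> \<Longrightarrow> okB \<tau>' \<beta> \<Longrightarrow> \<tau> = \<tau>'"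
    and fin: "finite (set_pmf p)" and M: "M \<ge> 0" and c: "c \<ge> 0"
  shows "1 - l1_dist (map_pmf (\<lambda>(\<alpha>, \<beta>). (tr \<alpha> \<beta>, WA \<alpha> (tr \<alpha> \<beta>), WB \<beta> (tr \<alpha> \<beta>))) S)
               (map_pmf (\<lambda>(\<tau>, w). (\<tau>, w, w)) (pair_pmf Q p))
       - measure_pmf.prob S {(\<alpha>, \<beta>). pmf S (\<alpha>, \<beta>) > M * pmf \<mu>A \<alpha> * pmf \<mu>B \<beta>}
       - measure_pmf.prob p {w. pmf p w > c}
     \<le> sqrt (M * c)"
    (is "1 - l1_dist ?O ?T - measure_pmf.prob S ?B - measure_pmf.prob p ?C \<le> _")
proof (rule field_le_epsilon)
  fix \<eta> :: real assume "\<eta> > 0"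
  then obtain F where F: "finite F" "(\<Sum>\<tau>\<in>F. pmf Q \<tau>) > 1 - \<eta>" by (rule pmf_finite_approx)
  have F1: "(\<Sum>\<tau>\<in>F. pmf Q \<tau>) \<le> 1"
    using F(1) by (simp flip: measure_measure_pmf_finite)
  \<comment> \<open>Values that are easy to guess are discarded here; their total weight is the last
    term subtracted in the claim.\<close>
  define W where "W = {w \<in> set_pmf p. pmf p w \<le> c}"
  have W: "finite W" using fin by (simp add: W_def)
  have "measure_pmf.prob p UNIV = measure_pmf.prob p (W \<union> ?C)"
    by (intro measure_pmf.finite_measure_eq_AE AE_pmfI) (auto simp: W_def)
  then have "1 = measure_pmf.prob p (W \<union> ?C)" by simp
  also have "\<dots> \<le> measure_pmf.prob p W + measure_pmf.prob p ?C"
    by (rule measure_subadditive) auto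
  finally have pW: "(\<Sum>w\<in>W. pmf p w) \<ge> 1 - measure_pmf.prob p ?C"
    using W by (simp add: measure_measure_pmf_finite)
  have pW1: "(\<Sum>w\<in>W. pmf p w) \<le> 1"
    using W by (simp flip: measure_measure_pmf_finite)
  define a where "a \<tau> w = measure_pmf.prob \<mu>A {\<alpha>. okA \<tau> \<alpha> \<and> WA \<alpha> \<tau> = w}" for \<tau> w
  define b where "b \<tau> w = measure_pmf.prob \<mu>B {\<beta>. okB \<tau> \<beta> \<and> WB \<beta> \<tau> = w}" for \<tau> w
  define A where "A \<tau> = measure_pmf.prob \<mu>A {\<alpha>. okA \<tau> \<alpha>}" for \<tau>
  define B where "B \<tau> = measure_pmf.prob \<mu>B {\<beta>. okB \<tau> \<beta>}" for \<tau>
  have ab: "a \<tau> w \<ge> 0" "b \<tau> w \<ge> 0" "A \<tau> \<ge> 0" "B \<tau> \<ge> 0" for \<tau> w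
    by (simp_all add: a_def b_def A_def B_def)
  define H where "H \<tau> w = {(\<alpha>, \<beta>). tr \<alpha> \<beta> = \<tau> \<and> WA \<alpha> \<tau> = w \<and> WB \<beta> \<tau> = w}" for \<tau> w
  define o' where "o' \<tau> w = pmf ?O (\<tau>, w, w)" for \<tau> w
  define s where "s \<tau> w = measure_pmf.prob S (H \<tau> w - ?B)" for \<tau> w
  have o': "o' \<tau> w = measure_pmf.prob S (H \<tau> w)" for \<tau> w
    unfolding o'_def pmf_map H_def by (intro arg_cong[where f = "measure_pmf.prob S"]) auto
  have s_le: "s \<tau> w \<le> M * (a \<tau> w * b \<tau> w)" for \<tau> w
  proof -
    \<comment> \<open>Outside \<open>?B\<close> the true inputs are at most \<open>M\<close> times
      likelier than independent ones. On the support, \<open>ok\<close> places the event inside a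
      rectangle, whose independent probability is a product.\<close>
    have "s \<tau> w = measure_pmf.prob S ((H \<tau> w - ?B) \<inter> set_pmf S)"
      by (simp add: s_def measure_Int_set_pmf)
    also have "\<dots> \<le> M * measure_pmf.prob (pair_pmf \<mu>A \<mu>B) ((H \<tau> w - ?B) \<inter> set_pmf S)"
      by (rule prob_le_of_pmf_le) (auto simp: pmf_pair mult_ac not_less)
    also have "\<dots> \<le> M * measure_pmf.prob (pair_pmf \<mu>A \<mu>B)
        ({\<alpha>. okA \<tau> \<alpha> \<and> WA \<alpha> \<tau> = w} \<times> {\<beta>. okB \<tau> \<beta> \<and> WB \<beta> \<tau> = w})"
      using M by (intro mult_left_mono measure_pmf.finite_measure_mono) (use ok in \<open>auto simp: H_def\<close>)
    finally show ?thesis by (simp add: prob_pair_pmf_Times a_def b_def)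
  qed
  \<comment> \<open>The target mass is at most its minimum with
    \<open>M * (a \<tau> w * b \<tau> w)\<close> plus the two correction terms: if the minimum is
    the latter, it is at least \<open>s \<tau> w\<close>, and the corrections lead from there to
    \<open>o' \<tau> w\<close> and on to the target. The minimum is then relaxed to the geometric
    mean.\<close>
  have pointwise: "pmf Q \<tau> * pmf p w \<le> sqrt (M * c) * sqrt (pmf Q \<tau> * (a \<tau> w * b \<tau> w))
      + \<bar>pmf ?O (\<tau>, w, w) - pmf ?T (\<tau>, w, w)\<bar> + (o' \<tau> w - s \<tau> w)" if "w \<in> W" for \<tau> w
  proof -
    have "pmf ?T (\<tau>, w, w) = pmf Q \<tau> * pmf p w"
      using pmf_map_inj'[of "\<lambda>(\<tau>, w). (\<tau>, w, w)" "pair_pmf Q p" "(\<tau>, w)"]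
      by (simp add: inj_def pmf_pair)
    moreover have "min x y \<le> sqrt (x * y)" if "x \<ge> 0" "y \<ge> 0" for x y :: real
      using that by (intro real_le_rsqrt) (auto simp: power2_eq_square min_def intro: mult_mono)
    then have "min (pmf Q \<tau> * pmf p w) (M * (a \<tau> w * b \<tau> w))
       \<le> sqrt ((pmf Q \<tau> * pmf p w) * (M * (a \<tau> w * b \<tau> w)))" using M ab by simp
    moreover have "\<dots> \<le> sqrt ((pmf Q \<tau> * c) * (M * (a \<tau> w * b \<tau> w)))"
      using that M ab by (intro real_sqrt_le_mono mult_right_mono mult_left_mono) (auto simp: W_def)
    moreover have "\<dots> = sqrt (M * c) * sqrt (pmf Q \<tau> * (a \<tau> w * b \<tau> w))"
      by (simp add: mult_ac flip: real_sqrt_mult)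
    moreover have "s \<tau> w \<le> o' \<tau> w"
      unfolding o' s_def by (rule measure_pmf.finite_measure_mono) auto
    ultimately show ?thesis using s_le[of \<tau> w] by (auto simp: o'_def min_def split: if_splits)
  qed
  \<comment> \<open>The events \<open>H \<tau> w\<close> are disjoint, so the parts removed from
    them fit together into \<open>?B\<close>.\<close>
  have rest: "(\<Sum>\<tau>\<in>F. \<Sum>w\<in>W. o' \<tau> w - s \<tau> w) \<le> measure_pmf.prob S ?B"
  proof -
    have "(\<Sum>\<tau>\<in>F. \<Sum>w\<in>W. o' \<tau> w - s \<tau> w) \<le> (\<Sum>(\<tau>, w)\<in>F \<times> W. measure_pmf.prob S (H \<tau> w \<inter> ?B))"
      unfolding sum.cartesian_product
      by (intro sum_mono) (auto simp: o' s_def measure_pmf.finite_measure_Diff' Int_commute)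
    also have "\<dots> \<le> measure_pmf.prob S ?B"
      using F(1) W sum_prob_disjoint_le[of "F \<times> W" "\<lambda>(\<tau>, w). H \<tau> w \<inter> ?B" ?B S]
      by (force simp: H_def case_prod_beta)
    finally show ?thesis .
  qed
  have close: "(\<Sum>\<tau>\<in>F. \<Sum>w\<in>W. \<bar>pmf ?O (\<tau>, w, w) - pmf ?T (\<tau>, w, w)\<bar>) \<le> l1_dist ?O ?T"
  proof -
    have "(\<Sum>\<tau>\<in>F. \<Sum>w\<in>W. \<bar>pmf ?O (\<tau>, w, w) - pmf ?T (\<tau>, w, w)\<bar>)
       = (\<Sum>x\<in>(\<lambda>(\<tau>, w). (\<tau>, w, w)) ` (F \<times> W). \<bar>pmf ?O x - pmf ?T x\<bar>)"
      by (subst sum.reindex) (auto simp: inj_on_def sum.cartesian_product case_prod_beta)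
    also have "\<dots> \<le> l1_dist ?O ?T" using F W by (intro sum_abs_diff_le_l1) auto
    finally show ?thesis .
  qed
  have aA: "(\<Sum>w\<in>W. a \<tau> w) \<le> A \<tau>" "(\<Sum>w\<in>W. b \<tau> w) \<le> B \<tau>" for \<tau>
    unfolding a_def b_def A_def B_def using W by (intro sum_prob_disjoint_le; auto)+
  have "(\<Sum>\<tau>\<in>F. A \<tau> * B \<tau>) = (\<Sum>\<tau>\<in>F. measure_pmf.prob (pair_pmf \<mu>A \<mu>B) ({\<alpha>. okA \<tau> \<alpha>} \<times> {\<beta>. okB \<tau> \<beta>}))"
    by (simp add: prob_pair_pmf_Times A_def B_def)
  also have "\<dots> \<le> measure_pmf.prob (pair_pmf \<mu>A \<mu>B) UNIV"
    using F(1) unique by (intro sum_prob_disjoint_le) auto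
  finally have AB: "(\<Sum>\<tau>\<in>F. A \<tau> * B \<tau>) \<le> 1" by (simp add: measure_pmf.prob_space[simplified])
  \<comment> \<open>Cauchy-Schwarz is applied twice: over \<open>w\<close>, where the slices of each
    side of the rectangle add up to at most the side, and then over \<tau>, where the disjoint
    rectangles have total weight at most 1.\<close>
  have "(\<Sum>\<tau>\<in>F. \<Sum>w\<in>W. sqrt (pmf Q \<tau> * (a \<tau> w * b \<tau> w))) \<le> (\<Sum>\<tau>\<in>F. sqrt (pmf Q \<tau> * (A \<tau> * B \<tau>)))"
  proof (rule sum_mono)
    fix \<tau>
    have "(\<Sum>w\<in>W. sqrt (pmf Q \<tau> * (a \<tau> w * b \<tau> w))) = sqrt (pmf Q \<tau>) * (\<Sum>w\<in>W. sqrt (a \<tau> w * b \<tau> w))"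
      by (simp add: real_sqrt_mult sum_distrib_left)
    also have "\<dots> \<le> sqrt (pmf Q \<tau>) * sqrt ((\<Sum>w\<in>W. a \<tau> w) * (\<Sum>w\<in>W. b \<tau> w))"
      using ab by (intro mult_left_mono sum_sqrt_mult_le) auto
    also have "\<dots> \<le> sqrt (pmf Q \<tau>) * sqrt (A \<tau> * B \<tau>)"
      using ab aA by (intro mult_left_mono real_sqrt_le_mono mult_mono sum_nonneg) auto
    finally show "(\<Sum>w\<in>W. sqrt (pmf Q \<tau> * (a \<tau> w * b \<tau> w))) \<le> sqrt (pmf Q \<tau> * (A \<tau> * B \<tau>))"
      by (simp add: real_sqrt_mult)
  qed
  also have "\<dots> \<le> sqrt ((\<Sum>\<tau>\<in>F. pmf Q \<tau>) * (\<Sum>\<tau>\<in>F. A \<tau> * B \<tau>))"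
    using ab by (intro sum_sqrt_mult_le) auto
  also have "\<dots> \<le> sqrt (1 * 1)"
    using ab F1 AB by (intro real_sqrt_le_mono mult_mono sum_nonneg) auto
  finally have root: "(\<Sum>\<tau>\<in>F. \<Sum>w\<in>W. sqrt (pmf Q \<tau> * (a \<tau> w * b \<tau> w))) \<le> 1" by simp
  have "(\<Sum>\<tau>\<in>F. pmf Q \<tau>) * (\<Sum>w\<in>W. pmf p w) = (\<Sum>\<tau>\<in>F. \<Sum>w\<in>W. pmf Q \<tau> * pmf p w)"
    by (rule sum_product)
  also have "\<dots> \<le> (\<Sum>\<tau>\<in>F. \<Sum>w\<in>W. sqrt (M * c) * sqrt (pmf Q \<tau> * (a \<tau> w * b \<tau> w))
      + \<bar>pmf ?O (\<tau>, w, w) - pmf ?T (\<tau>, w, w)\<bar> + (o' \<tau> w - s \<tau> w))"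
    by (intro sum_mono pointwise)
  also have "\<dots> = sqrt (M * c) * (\<Sum>\<tau>\<in>F. \<Sum>w\<in>W. sqrt (pmf Q \<tau> * (a \<tau> w * b \<tau> w)))
      + (\<Sum>\<tau>\<in>F. \<Sum>w\<in>W. \<bar>pmf ?O (\<tau>, w, w) - pmf ?T (\<tau>, w, w)\<bar>) + (\<Sum>\<tau>\<in>F. \<Sum>w\<in>W. o' \<tau> w - s \<tau> w)"
    by (simp add: sum.distrib sum_distrib_left)
  also have "\<dots> \<le> sqrt (M * c) * 1 + l1_dist ?O ?T + measure_pmf.prob S ?B"
    using M c by (intro add_mono mult_left_mono root close rest) auto
  finally have main: "(\<Sum>\<tau>\<in>F. pmf Q \<tau>) * (\<Sum>w\<in>W. pmf p w) \<le> sqrt (M * c) + l1_dist ?O ?T + measure_pmf.prob S ?B"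
    by simp
  have "(1 - (\<Sum>\<tau>\<in>F. pmf Q \<tau>)) * (\<Sum>w\<in>W. pmf p w) \<le> (1 - (\<Sum>\<tau>\<in>F. pmf Q \<tau>)) * 1"
    using F1 pW1 by (intro mult_left_mono) auto
  then have "(\<Sum>w\<in>W. pmf p w) - \<eta> \<le> (\<Sum>\<tau>\<in>F. pmf Q \<tau>) * (\<Sum>w\<in>W. pmf p w)"
    using F(2) by (simp add: algebra_simps)
  with main pW show "1 - l1_dist ?O ?T - measure_pmf.prob S ?B - measure_pmf.prob p ?C \<le> sqrt (M * c) + \<eta>"
    by linarith
qed

section \<open>Bi-disjoint sources\<close>

text \<open>The symmetric mixture is turned into a channel: \<open>K j\<close> is the law of XY
  given the label j, and the weights of the mixture are absorbed into the marginal of Z. This is the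
  form in which Bob can resample.\<close>

locale bi_disjoint_source =
  fixes P :: "('x::finite \<times> 'y::finite \<times> 'z::finite) pmf"
    and \<phi> :: "'x \<times> 'y \<Rightarrow> nat" and \<psi> :: "'z \<Rightarrow> nat" and K :: "nat \<Rightarrow> ('x \<times> 'y) pmf"
  assumes label: "(x, y, z) \<in> set_pmf P \<Longrightarrow> \<phi> (x, y) = \<psi> z"
    and factor: "pmf P (x, y, z) = pmf (map_pmf (\<lambda>(x, y, z). z) P) z * pmf (K (\<psi> z)) (x, y)"

text \<open>Disjointness of the supports leaves a single term of the mixture for each
  \<open>z\<close>, so that the component law \<open>PT\<close> serves as the channel.\<close>

lemma bi_disjoint_sourceI:
  fixes P :: "('x::finite \<times> 'y::finite \<times> 'z::finite) pmf"
  assumes "bi_disjoint (map_pmf (\<lambda>(x, y, z). ((x, y), z)) P)"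
  obtains \<phi> \<psi> K where "bi_disjoint_source P \<phi> \<psi> K"
proof -
  define P' where "P' = map_pmf (\<lambda>(x, y, z). ((x, y), z)) P"
  have P': "pmf P' ((x, y), z) = pmf P (x, y, z)" for x y z
    using pmf_map_inj'[of "\<lambda>(x, y, z). ((x, y), z)" P "(x, y, z)"] by (simp add: P'_def inj_def)
  obtain L :: "nat set" and p :: "nat \<Rightarrow> real" and PT PZ where L: "finite L"
    and disj: "\<And>i j t. i \<in> L \<Longrightarrow> j \<in> L \<Longrightarrow> pmf (PT i) t \<noteq> 0 \<Longrightarrow> pmf (PT j) t \<noteq> 0 \<Longrightarrow> i = j"
      "\<And>i j z. i \<in> L \<Longrightarrow> j \<in> L \<Longrightarrow> pmf (PZ i) z \<noteq> 0 \<Longrightarrow> pmf (PZ j) z \<noteq> 0 \<Longrightarrow> i = j"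
    and decomp: "\<And>t z. pmf P' (t, z) = (\<Sum>i\<in>L. p i * pmf (PT i) t * pmf (PZ i) z)"
  proof -
    from assms obtain L :: "nat set" and p :: "nat \<Rightarrow> real" and PT PZ where *: "finite L"
      "\<forall>i\<in>L. \<forall>j\<in>L. i \<noteq> j \<longrightarrow>
            (\<forall>t. pmf (PT i) t * pmf (PT j) t = 0) \<and> (\<forall>z. pmf (PZ i) z * pmf (PZ j) z = 0)"
      "\<forall>t z. pmf P' (t, z) = (\<Sum>i\<in>L. p i * pmf (PT i) t * pmf (PZ i) z)"
      unfolding bi_disjoint_def P'_def by blast
    show ?thesis
    proof (rule that[of L PT PZ p])
      show "i = j" if "i \<in> L" "j \<in> L" "pmf (PT i) t \<noteq> 0" "pmf (PT j) t \<noteq> 0" for i j t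
        using *(2) that by (metis mult_eq_0_iff)
      show "i = j" if "i \<in> L" "j \<in> L" "pmf (PZ i) z \<noteq> 0" "pmf (PZ j) z \<noteq> 0" for i j z
        using *(2) that by (metis mult_eq_0_iff)
    qed (use * in auto)
  qed
  have single: "pmf P' (t, z) = p i * pmf (PT i) t * pmf (PZ i) z" if "i \<in> L" "pmf (PZ i) z \<noteq> 0" for i t z
  proof -
    have "pmf P' (t, z) = (\<Sum>j\<in>{i}. p j * pmf (PT j) t * pmf (PZ j) z)"
      unfolding decomp
    proof (rule sum.mono_neutral_right)
      show "\<forall>j\<in>L - {i}. p j * pmf (PT j) t * pmf (PZ j) z = 0"
        using disj(2)[OF that(1) _ that(2)] by fastforce
    qed (use L that in auto)
    then show ?thesis by simp
  qed
  \<comment> \<open>The choice is unique by disjointness wherever some component has mass. Elsewhere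
    its value is arbitrary.\<close>
  define \<psi> where "\<psi> z = (SOME i. i \<in> L \<and> pmf (PZ i) z \<noteq> 0)" for z
  define \<phi> where "\<phi> t = (SOME i. i \<in> L \<and> pmf (PT i) t \<noteq> 0)" for t
  have supp: "i \<in> L \<and> \<psi> z = i \<and> \<phi> t = i" if "i \<in> L" "p i * pmf (PT i) t * pmf (PZ i) z \<noteq> 0" for i t z
  proof -
    have "i \<in> L \<and> pmf (PZ i) z \<noteq> 0" "i \<in> L \<and> pmf (PT i) t \<noteq> 0" using that by auto
    then show ?thesis unfolding \<psi>_def \<phi>_def by (blast intro: some_equality disj)
  qed
  have ex: "\<exists>i\<in>L. p i * pmf (PT i) t * pmf (PZ i) z \<noteq> 0" if "pmf P' (t, z) \<noteq> 0" for t z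
    using that unfolding decomp by (meson sum.neutral)
  have marg: "pmf (map_pmf (\<lambda>(x, y, z). z) P) z = (\<Sum>t\<in>UNIV. pmf P' (t, z))" for z
    using sum_pmf_eq_marginal[of UNIV P' z] by (simp add: P'_def map_pmf_comp case_prod_unfold)
  show ?thesis
  proof (rule that[of \<phi> \<psi> PT], unfold_locales)
    fix x y z
    show "\<phi> (x, y) = \<psi> z" if "(x, y, z) \<in> set_pmf P"
      using ex[of "(x, y)" z] that supp by (metis P' set_pmf_iff)
    show "pmf P (x, y, z) = pmf (map_pmf (\<lambda>(x, y, z). z) P) z * pmf (PT (\<psi> z)) (x, y)"
    \<comment> \<open>In the null case both sides vanish, which makes an arbitrary label
      harmless.\<close>
    proof (cases "pmf (map_pmf (\<lambda>(x, y, z). z) P) z = 0")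
      case True
      then have "(\<forall>t\<in>UNIV. pmf P' (t, z) = 0)" unfolding marg
        by (subst (asm) sum_nonneg_eq_0_iff) auto
      with True P' show ?thesis by (metis UNIV_I mult_zero_left)
    next
      case False
      then obtain t where "pmf P' (t, z) \<noteq> 0" unfolding marg by (meson sum.neutral)
      then obtain i where i: "i \<in> L" "pmf (PZ i) z \<noteq> 0" "\<psi> z = i"
        using ex supp by (metis mult_zero_right)
      have "pmf (map_pmf (\<lambda>(x, y, z). z) P) z = p i * pmf (PZ i) z * (\<Sum>t\<in>UNIV. pmf (PT i) t)"
        unfolding marg by (simp add: single[OF i(1,2)] sum_distrib_left mult_ac)
      also have "(\<Sum>t\<in>UNIV. pmf (PT i) t) = 1" by (rule sum_pmf_eq_1) auto
      finally show ?thesis using single[OF i(1,2), of "(x, y)"] i(3) by (simp add: P')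
    qed
  qed
qed

text \<open>Every marginal entropy becomes an expectation over the one space of \<open>p\<close>, so
  entropy identities can be checked pointwise on log densities.\<close>

lemma shannon_H_map_pmf:
  fixes f :: "'a \<Rightarrow> 'b::finite"
  shows "shannon_H (map_pmf f p) = - measure_pmf.expectation p (\<lambda>w. log 2 (pmf (map_pmf f p) (f w)))"
proof -
  have "shannon_H q = - measure_pmf.expectation q (\<lambda>a. log 2 (pmf q a))" for q :: "'b pmf"
    by (subst integral_measure_pmf_real[of UNIV])
       (auto simp: shannon_H_def mult.commute intro!: sum.cong)
  from this[of "map_pmf f p"] show ?thesis by simp
qed

lemma pmf_map_pos: "w \<in> set_pmf p \<Longrightarrow> pmf (map_pmf f p) (f w) > 0"
  by (simp add: pmf_positive)

definition cond_density :: "('a \<times> 'b) pmf \<Rightarrow> 'a \<times> 'b \<Rightarrow> real" where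
  "cond_density q w = pmf q w / pmf (map_pmf snd q) (snd w)"

lemma cond_density_pos: "w \<in> set_pmf q \<Longrightarrow> cond_density q w > 0"
  unfolding cond_density_def by (intro divide_pos_pos pmf_map_pos) (auto simp: pmf_positive)

lemma cond_density_le_1: "cond_density q w \<le> 1"
  using sum_pmf_le_marginal[of "{fst w}" q "snd w"] by (auto simp: cond_density_def intro!: divide_le_eq_1[THEN iffD2])

abbreviation (input) "to_xy \<equiv> \<lambda>(x, y, z). (x, y)"
abbreviation (input) "to_xz \<equiv> \<lambda>(x, y, z). (x, z)"
abbreviation (input) "to_y \<equiv> \<lambda>(x, y, z). y"
abbreviation (input) "to_z \<equiv> \<lambda>(x, y, z). z"

lemma mutual_info_difference:
  fixes P :: "('x::finite \<times> 'y::finite \<times> 'z::finite) pmf"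
  shows "mutual_info (map_pmf to_xz P) - mutual_info (map_pmf to_xy P)
    = shannon_H (map_pmf to_xy P) + shannon_H (map_pmf to_z P)
      - shannon_H (map_pmf to_xz P) - shannon_H (map_pmf to_y P)"
  by (simp add: mutual_info_def map_pmf_comp case_prod_unfold)

context bi_disjoint_source
begin

definition label_pmf :: "nat pmf" where "label_pmf = map_pmf (\<psi> \<circ> to_z) P"

definition rate :: real where
  "rate = mutual_info (map_pmf to_xz P) - mutual_info (map_pmf to_xy P)"

text \<open>XY and Z are independent given a label that either side determines, so their likelihood
  ratio against independence is the inverse label probability. This is the pointwise form of I(XY:Z)
  = H(J).\<close>

lemma label_pmf_identity:
  assumes "w \<in> set_pmf P"
  shows "pmf label_pmf (\<psi> (to_z w)) * pmf P w = pmf (map_pmf to_xy P) (to_xy w) * pmf (map_pmf to_z P) (to_z w)"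
proof -
  obtain x y z where w: "w = (x, y, z)" by (cases w)
  let ?Z = "map_pmf to_z P"
  let ?k = "pmf (K (\<psi> z)) (x, y)"
  have "pmf (map_pmf to_xy P) (x, y) = measure_pmf.prob P ((\<lambda>z'. (x, y, z')) ` UNIV)"
    unfolding pmf_map by (intro arg_cong[where f = "measure_pmf.prob P"]) auto
  also have "\<dots> = (\<Sum>z'\<in>UNIV. pmf P (x, y, z'))"
    by (simp add: measure_measure_pmf_finite sum.reindex inj_on_def)
  \<comment> \<open>The pair (x, y) fixes the label, so only those \<open>z'\<close> that carry it
    contribute, all with the same channel value.\<close>
  also have "\<dots> = (\<Sum>z'\<in>\<psi> -` {\<psi> z}. pmf ?Z z' * ?k)"
  proof (rule sum.mono_neutral_cong_right)
    show "\<forall>z'\<in>UNIV - \<psi> -` {\<psi> z}. pmf P (x, y, z') = 0"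
      using label assms unfolding w by (metis DiffE set_pmf_iff vimage_singleton_eq)
  qed (auto simp: factor)
  also have "\<dots> = pmf (map_pmf \<psi> ?Z) (\<psi> z) * ?k"
    by (subst pmf_map) (simp add: measure_measure_pmf_finite sum_distrib_right del: measure_map_pmf)
  also have "map_pmf \<psi> ?Z = label_pmf" by (simp add: label_pmf_def map_pmf_comp o_def)
  finally have "pmf (map_pmf to_xy P) (x, y) = pmf label_pmf (\<psi> z) * ?k" .
  then show ?thesis by (simp add: w factor[of x y z])
qed

lemma source_eq_bind: "P = do {z \<leftarrow> map_pmf to_z P; (x, y) \<leftarrow> K (\<psi> z); return_pmf (x, y, z)}"
proof (rule pmf_eqI, clarify)
  fix x y z
  let ?Z = "map_pmf to_z P"
  let ?L = "\<lambda>z'. map_pmf (\<lambda>(x, y). (x, y, z')) (K (\<psi> z'))"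
  have L: "pmf (?L z') (x, y, z) = (if z' = z then pmf (K (\<psi> z)) (x, y) else 0)" for z'
    using pmf_map_inj'[of "\<lambda>(x, y). (x, y, z')" "K (\<psi> z')" "(x, y)"]
    by (auto simp: inj_def pmf_eq_0_set_pmf)
  have "pmf (do {z \<leftarrow> ?Z; (x, y) \<leftarrow> K (\<psi> z); return_pmf (x, y, z)}) (x, y, z) = pmf (bind_pmf ?Z ?L) (x, y, z)"
    by (simp add: map_pmf_def case_prod_unfold)
  also have "\<dots> = (\<Sum>z'\<in>UNIV. (if z' = z then pmf (K (\<psi> z)) (x, y) else 0) * pmf ?Z z')"
    unfolding pmf_bind L by (rule integral_measure_pmf_real) auto
  also have "\<dots> = pmf ?Z z * pmf (K (\<psi> z)) (x, y)"
    by (simp add: if_distrib[of "\<lambda>a. a * _"] cong: if_cong)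
  finally show "pmf P (x, y, z) = pmf (do {z \<leftarrow> ?Z; (x, y) \<leftarrow> K (\<psi> z); return_pmf (x, y, z)}) (x, y, z)"
    by (simp add: factor)
qed

text \<open>The mean of \<open>log 2 dens_y\<close> is $I(XZ:Y)$, and that of \<open>log 2 dens_label\<close> is
  $-H(J) = -I(XY:Z)$.\<close>

definition dens_y where "dens_y w = pmf P w / (pmf (map_pmf to_xz P) (to_xz w) * pmf (map_pmf to_y P) (to_y w))"
definition dens_label where "dens_label w = pmf label_pmf (\<psi> (to_z w))"

lemma dens_pos:
  assumes "w \<in> set_pmf P"
  shows "dens_y w > 0" "dens_label w > 0"
proof -
  have "dens_label w > 0"
    using pmf_map_pos[OF assms, of "\<psi> \<circ> to_z"] by (simp add: dens_label_def label_pmf_def)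
  then show "dens_y w > 0" "dens_label w > 0"
    using pmf_map_pos[OF assms] assms
    by (auto simp: dens_y_def pmf_positive intro!: divide_pos_pos mult_pos_pos)
qed

definition log_marginal where "log_marginal f w = log 2 (pmf (map_pmf f P) (f w))"

lemma expectation_log_marginal:
  "measure_pmf.expectation P (log_marginal f) = - shannon_H (map_pmf f P)" for f :: "_ \<Rightarrow> 'c::finite"
  by (simp add: shannon_H_map_pmf log_marginal_def[abs_def])

text \<open>Two readings of the rate: H(J) - I(XZ:Y), which the converse meets, and H(X|Y) - H(X|Z),
  which the protocol meets. The first rests on the label identity.\<close>

lemma expectation_log_dens:
  shows "measure_pmf.expectation P (\<lambda>w. log 2 (dens_y w)) + measure_pmf.expectation P (\<lambda>w. log 2 (dens_label w)) = - rate"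
    and "measure_pmf.expectation (map_pmf to_xz P) (\<lambda>w. log 2 (cond_density (map_pmf to_xz P) w))
       - measure_pmf.expectation (map_pmf to_xy P) (\<lambda>w. log 2 (cond_density (map_pmf to_xy P) w)) = rate"
proof -
  note int = integrable_measure_pmf_finite[OF finite[of "set_pmf P"]]
  note h_def = log_marginal_def and H = expectation_log_marginal
  have AE: "measure_pmf.expectation P f = measure_pmf.expectation P g"
    if "\<And>w. w \<in> set_pmf P \<Longrightarrow> f w = g w" for f g :: "_ \<Rightarrow> real"
    by (intro integral_cong_AE AE_pmfI that) auto
  have ln: "log 2 (dens_y w) + log 2 (dens_label w) = log_marginal to_xy w + log_marginal to_z w - log_marginal to_xz w - log_marginal to_y w"
    "log 2 (cond_density (map_pmf to_xz P) (to_xz w)) - log 2 (cond_density (map_pmf to_xy P) (to_xy w)) = log_marginal to_xz w - log_marginal to_z w - (log_marginal to_xy w - log_marginal to_y w)"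
    if w: "w \<in> set_pmf P" for w
  proof -
    have pos: "pmf (map_pmf f P) (f w) > 0" for f :: "_ \<Rightarrow> 'c" by (rule pmf_map_pos[OF w])
    have posP: "pmf P w > 0" using w by (rule pmf_positive)
    have "log 2 (dens_label w * pmf P w) = log_marginal to_xy w + log_marginal to_z w"
      unfolding dens_label_def label_pmf_identity[OF w] h_def by (rule log_mult_pos[OF pos pos])
    then have l: "log 2 (dens_label w) + log 2 (pmf P w) = log_marginal to_xy w + log_marginal to_z w"
      using dens_pos[OF w] posP by (simp add: log_mult_pos)
    have y: "log 2 (dens_y w) = log 2 (pmf P w) - (log_marginal to_xz w + log_marginal to_y w)"
      unfolding dens_y_def h_def
      by (subst log_divide_pos[OF posP mult_pos_pos[OF pos pos]], subst log_mult_pos[OF pos pos]) simp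
    from l y show "log 2 (dens_y w) + log 2 (dens_label w) = log_marginal to_xy w + log_marginal to_z w - log_marginal to_xz w - log_marginal to_y w"
      by simp
    show "log 2 (cond_density (map_pmf to_xz P) (to_xz w)) - log 2 (cond_density (map_pmf to_xy P) (to_xy w)) = log_marginal to_xz w - log_marginal to_z w - (log_marginal to_xy w - log_marginal to_y w)"
      using pos[of to_xy] pos[of to_xz] pos[of to_y] pos[of to_z]
      by (cases w) (simp add: cond_density_def h_def map_pmf_comp log_divide_pos case_prod_unfold)
  qed
  have "measure_pmf.expectation P (\<lambda>w. log 2 (dens_y w)) + measure_pmf.expectation P (\<lambda>w. log 2 (dens_label w))
     = measure_pmf.expectation P (\<lambda>w. log_marginal to_xy w + log_marginal to_z w - log_marginal to_xz w - log_marginal to_y w)"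
    by (subst Bochner_Integration.integral_add[symmetric, OF int int], rule AE, rule ln(1))
  then show "measure_pmf.expectation P (\<lambda>w. log 2 (dens_y w)) + measure_pmf.expectation P (\<lambda>w. log 2 (dens_label w)) = - rate"
    by (simp add: int H rate_def mutual_info_difference)
  have "measure_pmf.expectation P (\<lambda>w. log 2 (cond_density (map_pmf to_xz P) (to_xz w))) - measure_pmf.expectation P (\<lambda>w. log 2 (cond_density (map_pmf to_xy P) (to_xy w)))
     = measure_pmf.expectation P (\<lambda>w. log_marginal to_xz w - log_marginal to_z w - (log_marginal to_xy w - log_marginal to_y w))"
    by (subst Bochner_Integration.integral_diff[symmetric, OF int int], rule AE, rule ln(2))
  then show "measure_pmf.expectation (map_pmf to_xz P) (\<lambda>w. log 2 (cond_density (map_pmf to_xz P) w))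
       - measure_pmf.expectation (map_pmf to_xy P) (\<lambda>w. log 2 (cond_density (map_pmf to_xy P) w)) = rate"
    by (simp add: int H rate_def mutual_info_difference)
qed

end

section \<open>Converse\<close>

lemma finite_bool_lists: "finite {ks :: bool list. length ks = k}"
  using finite_lists_length_eq[of "UNIV :: bool set" k] by simp

lemma card_bool_lists: "card {ks :: bool list. length ks = k} = 2 ^ k"
  using card_lists_length_eq[of "UNIV :: bool set" k] by simp

lemma bool_lists_nonempty: "{ks :: bool list. length ks = k} \<noteq> {}"
  by (auto intro: exI[of _ "replicate k True"])

lemma set_key_pmf: "set_pmf (key_pmf k) = {ks. length ks = k}"
  unfolding key_pmf_def using bool_lists_nonempty finite_bool_lists by (rule set_pmf_of_set)

lemma pmf_key_pmf: "length ks = k \<Longrightarrow> pmf (key_pmf k) ks = 1 / 2 ^ k"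
  unfolding key_pmf_def by (subst pmf_of_set) (auto simp: card_bool_lists bool_lists_nonempty finite_bool_lists)

section \<open>Transcripts and rectangles\<close>

lemma length_transcript [simp]: "length (transcript prot xs ys key a b n) = n"
  by (induction n) (auto simp: Let_def)

lemma take_transcript:
  "i \<le> n \<Longrightarrow> take i (transcript prot xs ys key a b n) = transcript prot xs ys key a b i"
  by (induction n) (auto simp: Let_def le_Suc_eq)

lemma nth_transcript:
  assumes "i < n"
  shows "transcript prot xs ys key a b n ! i = 
    (if even i then msgA prot xs key a (take i (transcript prot xs ys key a b n))
     else msgB prot ys key b (take i (transcript prot xs ys key a b n)))"
proof -
  have "transcript prot xs ys key a b n ! i = take (Suc i) (transcript prot xs ys key a b n) ! i"
    by simp
  also have "\<dots> = transcript prot xs ys key a b (Suc i) ! i"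
    using assms by (simp only: take_transcript Suc_leI)
  finally show ?thesis using assms by (simp add: Let_def nth_append take_transcript)
qed

text \<open>Each message is compared with the prefix of the given \<tau> and not with an actual run.
  The condition therefore involves Alice's data alone, and the inputs compatible with \<tau> form a
  product set.\<close>

definition consistentA :: "('x, 'y) lopc \<Rightarrow> nat list \<Rightarrow> 'x list \<Rightarrow> bool list \<Rightarrow> nat \<Rightarrow> bool" where
  "consistentA prot \<tau> xs key a \<longleftrightarrow> length \<tau> = nrounds prot \<and>
     (\<forall>i<nrounds prot. even i \<longrightarrow> \<tau> ! i = msgA prot xs key a (take i \<tau>))"

definition consistentB :: "('x, 'y) lopc \<Rightarrow> nat list \<Rightarrow> 'y list \<Rightarrow> bool list \<Rightarrow> nat \<Rightarrow> bool" where
  "consistentB prot \<tau> ys key b \<longleftrightarrow> length \<tau> = nrounds prot \<and>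
     (\<forall>i<nrounds prot. odd i \<longrightarrow> \<tau> ! i = msgB prot ys key b (take i \<tau>))"

lemma consistent_transcript:
  "consistentA prot (transcript prot xs ys key a b (nrounds prot)) xs key a"
  "consistentB prot (transcript prot xs ys key a b (nrounds prot)) ys key b"
  by (simp_all add: consistentA_def consistentB_def nth_transcript)

text \<open>By induction on prefixes, every message is forced by its speaker's data. The two keys
  may differ because the rectangles are also measured under independent inputs, where the keys are
  unrelated.\<close>

lemma consistent_unique:
  assumes "consistentA prot \<tau> xs key a" "consistentB prot \<tau> ys key' b"
    "consistentA prot \<tau>' xs key a" "consistentB prot \<tau>' ys key' b"
  shows "\<tau> = \<tau>'"
proof -
  have len: "length \<tau> = nrounds prot" "length \<tau>' = nrounds prot"
    using assms by (auto simp: consistentA_def)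
  have "take i \<tau> = take i \<tau>'" if "i \<le> nrounds prot" for i
    using that
  proof (induction i)
    case (Suc i)
    then have i: "i < nrounds prot" and eq: "take i \<tau> = take i \<tau>'" by auto
    have "\<tau> ! i = \<tau>' ! i"
      using assms i eq by (cases "even i") (auto simp: consistentA_def consistentB_def)
    then show ?case using i eq len by (simp add: take_Suc_conv_app_nth)
  qed simp
  from this[of "nrounds prot"] show ?thesis using len by simp
qed

context bi_disjoint_source
begin

lemma prod_list_dens_y:
  assumes "set t \<subseteq> set_pmf P"
  shows "prod_list (map (pmf P) t) = prod_list (map dens_y t)
    * (prod_list (map (pmf (map_pmf to_xz P)) (map to_xz t)) * prod_list (map (pmf (map_pmf to_y P)) (map to_y t)))"
  using assms
proof (induction t)
  case (Cons w t)
  then have w: "w \<in> set_pmf P" by simp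
  have "pmf P w = dens_y w * (pmf (map_pmf to_xz P) (to_xz w) * pmf (map_pmf to_y P) (to_y w))"
    using pmf_map_pos[OF w, of to_xz] pmf_map_pos[OF w, of to_y] by (simp add: dens_y_def)
  with Cons show ?case by (simp add: mult_ac)
qed simp

text \<open>The reference is placed on Alice's side, and the common value is the final key together
  with the label block. The two variance terms account for atypical XZ-Y correlation and for
  atypically likely label blocks.\<close>

lemma converse_one_shot:
  fixes prot :: "('x, 'y) lopc" and PE :: "'e pmf"
  assumes n: "n > 0" and \<delta>: "\<delta> > 0"
  defines "Ly \<equiv> measure_pmf.expectation P (\<lambda>w. log 2 (dens_y w))"
    and "Ll \<equiv> measure_pmf.expectation P (\<lambda>w. log 2 (dens_label w))"
  shows "1 - merge_error P PE n k l prot Q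
     - measure_pmf.expectation P (\<lambda>w. (log 2 (dens_y w) - Ly)\<^sup>2) / (n * \<delta>\<^sup>2)
     - measure_pmf.expectation P (\<lambda>w. (log 2 (dens_label w) - Ll)\<^sup>2) / (n * \<delta>\<^sup>2)
    \<le> sqrt ((2 ^ k * 2 powr (n * (Ly + \<delta>))) * ((1 / 2 ^ l) * 2 powr (n * (Ll + \<delta>))))"
proof -
  let ?I = "iid_pmf n P"
  \<comment> \<open>Both views contain the initial key. Its probability enters once in
    \<open>S\<close> but twice in the product of \<open>\<mu>A\<close> and \<open>\<mu>B\<close>,
    whence the factor \<open>2 ^ k\<close> in \<open>M\<close>.\<close>
  define view where "view = (\<lambda>(t, key :: bool list, a :: nat, b :: nat).
     ((map to_xz (t :: ('x \<times> 'y \<times> 'z) list), key, a), (map to_y t, key, b)))"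
  define \<Omega> where "\<Omega> = pair_pmf ?I (pair_pmf (key_pmf k) (pair_pmf (randA prot) (randB prot)))"
  define S where "S = map_pmf view \<Omega>"
  define tr where "tr = (\<lambda>(xzs, key, a) (ys, key' :: bool list, b).
     transcript prot (map fst (xzs :: ('x \<times> 'z) list)) ys key a b (nrounds prot))"
  define okA where "okA \<tau> = (\<lambda>(xzs, key, a). consistentA prot \<tau> (map fst (xzs :: ('x \<times> 'z) list)) key a)" for \<tau>
  define okB where "okB \<tau> = (\<lambda>(ys, key, b). consistentB prot \<tau> ys key b)" for \<tau>
  define WA where "WA = (\<lambda>(xzs, key, a) \<tau>. (outA prot (map fst xzs) key a \<tau>, map (\<psi> \<circ> snd) xzs))"
  define WB where "WB = (\<lambda>(ys, key, b) \<tau>. (fst (outB prot ys key b \<tau>), map \<phi> (snd (outB prot ys key b \<tau>))))"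
  define p where "p = pair_pmf (key_pmf l) (iid_pmf n label_pmf)"
  define \<mu>A where "\<mu>A = pair_pmf (iid_pmf n (map_pmf to_xz P)) (pair_pmf (key_pmf k) (randA prot))"
  define \<mu>B where "\<mu>B = pair_pmf (iid_pmf n (map_pmf to_y P)) (pair_pmf (key_pmf k) (randB prot))"
  define M where "M = 2 ^ k * 2 powr (n * (Ly + \<delta>))"
  define c where "c = (1 / 2 ^ l) * 2 powr (n * (Ll + \<delta>))"
  \<comment> \<open>A common post-processing of real output and target, which can only decrease
    their distance. Alice's side takes the labels from Z^n, Bob's from the pairs that he outputs; in
    the target the two agree.\<close>
  define read where "read = (\<lambda>(u :: bool list, (v :: bool list, th), zs, es :: 'e list, \<tau> :: nat list).
     (\<tau>, (u, map \<psi> zs), (v, map \<phi> th)))"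
  have fin_label: "finite (set_pmf label_pmf)" by (simp add: label_pmf_def)
  have S_bind: "S = do {t \<leftarrow> ?I; key \<leftarrow> key_pmf k; a \<leftarrow> randA prot; b \<leftarrow> randB prot; return_pmf (view (t, key, a, b))}"
    by (simp add: S_def \<Omega>_def map_pmf_def pair_pmf_def bind_assoc_pmf bind_return_pmf)
  have out: "map_pmf read (lopc_output P PE n k prot)
     = map_pmf (\<lambda>(\<alpha>, \<beta>). (tr \<alpha> \<beta>, WA \<alpha> (tr \<alpha> \<beta>), WB \<beta> (tr \<alpha> \<beta>))) S"
    unfolding lopc_output_def S_bind
    by (simp add: map_bind_pmf Let_def read_def view_def tr_def WA_def WB_def o_def case_prod_unfold)
  have target: "map_pmf read (merge_target P PE n l Q) = map_pmf (\<lambda>(\<tau>, w). (\<tau>, w, w)) (pair_pmf Q p)"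
  proof -
    have lab: "map \<phi> (map to_xy t) = map (\<psi> \<circ> to_z) t" if "t \<in> set_pmf ?I" for t
    proof -
      have "\<phi> (to_xy w) = \<psi> (to_z w)" if "w \<in> set_pmf P" for w
        using label that by (cases w) auto
      then show ?thesis using that by (auto simp: set_iid_pmf)
    qed
    have "map_pmf read (merge_target P PE n l Q)
       = do {t \<leftarrow> ?I; key \<leftarrow> key_pmf l; \<tau> \<leftarrow> Q; return_pmf (\<tau>, (key, map (\<psi> \<circ> to_z) t), (key, map \<phi> (map to_xy t)))}"
      by (simp add: merge_target_def map_bind_pmf read_def o_def case_prod_unfold)
    also have "\<dots> = do {t \<leftarrow> ?I; key \<leftarrow> key_pmf l; \<tau> \<leftarrow> Q; return_pmf (\<tau>, (key, map (\<psi> \<circ> to_z) t), (key, map (\<psi> \<circ> to_z) t))}"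
      by (intro bind_pmf_cong refl) (simp only: lab)
    also have "\<dots> = do {js \<leftarrow> map_pmf (map (\<psi> \<circ> to_z)) ?I; key \<leftarrow> key_pmf l; \<tau> \<leftarrow> Q; return_pmf (\<tau>, (key, js), (key, js))}"
      by (simp add: bind_map_pmf)
    also have "map_pmf (map (\<psi> \<circ> to_z)) ?I = iid_pmf n label_pmf"
      by (simp only: map_iid_pmf label_pmf_def)
    also have "do {js \<leftarrow> iid_pmf n label_pmf; key \<leftarrow> key_pmf l; \<tau> \<leftarrow> Q; return_pmf (\<tau>, (key, js), (key, js))}
       = do {\<tau> \<leftarrow> Q; js \<leftarrow> iid_pmf n label_pmf; key \<leftarrow> key_pmf l; return_pmf (\<tau>, (key, js), (key, js))}"
      by (subst (2) bind_commute_pmf, subst bind_commute_pmf) rule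
    also have "\<dots> = do {\<tau> \<leftarrow> Q; key \<leftarrow> key_pmf l; js \<leftarrow> iid_pmf n label_pmf; return_pmf (\<tau>, (key, js), (key, js))}"
      by (subst (2) bind_commute_pmf) rule
    also have "\<dots> = map_pmf (\<lambda>(\<tau>, w). (\<tau>, w, w)) (pair_pmf Q p)"
      by (simp add: p_def map_pmf_def pair_pmf_def bind_assoc_pmf bind_return_pmf)
    finally show ?thesis .
  qed
  have "1 - l1_dist (map_pmf (\<lambda>(\<alpha>, \<beta>). (tr \<alpha> \<beta>, WA \<alpha> (tr \<alpha> \<beta>), WB \<beta> (tr \<alpha> \<beta>))) S)
               (map_pmf (\<lambda>(\<tau>, w). (\<tau>, w, w)) (pair_pmf Q p))
       - measure_pmf.prob S {(\<alpha>, \<beta>). pmf S (\<alpha>, \<beta>) > M * pmf \<mu>A \<alpha> * pmf \<mu>B \<beta>}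
       - measure_pmf.prob p {w. pmf p w > c} \<le> sqrt (M * c)"
  proof (rule common_randomness_converse[where okA = okA and okB = okB])
    show "okA (tr \<alpha> \<beta>) \<alpha> \<and> okB (tr \<alpha> \<beta>) \<beta>" if "(\<alpha>, \<beta>) \<in> set_pmf S" for \<alpha> \<beta>
      using that by (auto simp: S_def view_def okA_def okB_def tr_def consistent_transcript)
    show "\<tau> = \<tau>'" if "okA \<tau> \<alpha>" "okB \<tau> \<beta>" "okA \<tau>' \<alpha>" "okB \<tau>' \<beta>" for \<tau> \<tau>' \<alpha> \<beta>
      using that by (cases \<alpha>; cases \<beta>) (auto simp: okA_def okB_def intro: consistent_unique)
    show "finite (set_pmf p)"
      using fin_label by (simp add: p_def set_key_pmf finite_bool_lists finite_set_iid_pmf)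
  qed (simp_all add: M_def c_def)
  moreover have "l1_dist (map_pmf (\<lambda>(\<alpha>, \<beta>). (tr \<alpha> \<beta>, WA \<alpha> (tr \<alpha> \<beta>), WB \<beta> (tr \<alpha> \<beta>))) S)
               (map_pmf (\<lambda>(\<tau>, w). (\<tau>, w, w)) (pair_pmf Q p)) \<le> merge_error P PE n k l prot Q"
    unfolding out[symmetric] target[symmetric] merge_error_def by (rule l1_dist_map_le)
  moreover have "measure_pmf.prob S {(\<alpha>, \<beta>). pmf S (\<alpha>, \<beta>) > M * pmf \<mu>A \<alpha> * pmf \<mu>B \<beta>}
     \<le> measure_pmf.expectation P (\<lambda>w. (log 2 (dens_y w) - Ly)\<^sup>2) / (n * \<delta>\<^sup>2)"
  proof -
    \<comment> \<open>The views together determine the source block, so \<open>view\<close> is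
      injective and probabilities under \<open>S\<close> are those under \<Omega>.\<close>
    have merge: "map2 (\<lambda>(x, z) y. (x, y, z)) (map to_xz t) (map to_y t) = t" for t :: "('x \<times> 'y \<times> 'z) list"
      by (induction t) auto
    have inj: "inj view"
    proof (rule injI)
      fix v w assume "view v = view w"
      then show "v = w"
        using merge[of "fst v"] merge[of "fst w"] by (simp add: view_def case_prod_unfold prod_eq_iff)
    qed
    have atyp: "prod_list (map dens_y t) > 2 powr (n * (Ly + \<delta>))"
      if \<omega>: "(t, key, a, b) \<in> set_pmf \<Omega>"
        and big: "pmf S (view (t, key, a, b)) > M * pmf \<mu>A (fst (view (t, key, a, b))) * pmf \<mu>B (snd (view (t, key, a, b)))"
      for t key a b
    proof -
      have t: "length t = n" "set t \<subseteq> set_pmf P" and key: "length key = k"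
        and ab: "pmf (randA prot) a > 0" "pmf (randB prot) b > 0"
        using \<omega> by (auto simp: \<Omega>_def set_iid_pmf set_key_pmf pmf_positive)
      define r where "r = pmf (randA prot) a * pmf (randB prot) b / 2 ^ k"
      define m where "m = prod_list (map (pmf (map_pmf to_xz P)) (map to_xz t)) * prod_list (map (pmf (map_pmf to_y P)) (map to_y t))"
      have r: "r > 0" using ab by (simp add: r_def)
      have "pmf S (view (t, key, a, b)) = prod_list (map dens_y t) * m * r"
        unfolding S_def pmf_map_inj'[OF inj] using t key
        by (simp add: \<Omega>_def pmf_pair pmf_iid_pmf pmf_key_pmf prod_list_dens_y[OF t(2)] r_def m_def)
      moreover have "M * pmf \<mu>A (fst (view (t, key, a, b))) * pmf \<mu>B (snd (view (t, key, a, b)))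
         = 2 powr (n * (Ly + \<delta>)) * m * r"
        using t key by (simp add: view_def \<mu>A_def \<mu>B_def pmf_pair pmf_iid_pmf pmf_key_pmf M_def r_def m_def)
      ultimately have "2 powr (n * (Ly + \<delta>)) * (m * r) < prod_list (map dens_y t) * (m * r)"
        using big by (simp add: mult.assoc)
      moreover have "m * r \<ge> 0" using r by (auto simp: m_def intro!: mult_nonneg_nonneg prod_list_nonneg)
      ultimately show ?thesis using mult_less_cancel_right_disj by (metis not_less)
    qed
    have "measure_pmf.prob S {(\<alpha>, \<beta>). pmf S (\<alpha>, \<beta>) > M * pmf \<mu>A \<alpha> * pmf \<mu>B \<beta>}
      \<le> measure_pmf.prob \<Omega> ({t. prod_list (map dens_y t) > 2 powr (n * (Ly + \<delta>))} \<times> UNIV)"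
      unfolding S_def measure_map_pmf
      by (intro measure_pmf.finite_measure_mono_AE AE_pmfI) (use atyp in \<open>auto simp: S_def case_prod_unfold\<close>)
    also have "\<dots> = measure_pmf.prob ?I {t. prod_list (map dens_y t) > 2 powr (n * (Ly + \<delta>))}"
      by (simp add: \<Omega>_def prob_pair_pmf_Times measure_pmf.prob_space[simplified])
    also have "\<dots> \<le> measure_pmf.expectation P (\<lambda>w. (log 2 (dens_y w) - Ly)\<^sup>2) / (n * \<delta>\<^sup>2)"
      using n \<delta> by (intro aep_upper) (auto simp: Ly_def dens_pos)
    finally show ?thesis .
  qed
  moreover have "measure_pmf.prob p {w. pmf p w > c}
     \<le> measure_pmf.expectation P (\<lambda>w. (log 2 (dens_label w) - Ll)\<^sup>2) / (n * \<delta>\<^sup>2)"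
  proof -
    \<comment> \<open>The final key is exactly uniform, so only the label block can make
      \<open>w\<close> too likely.\<close>
    have "measure_pmf.prob p {w. pmf p w > c}
       \<le> measure_pmf.prob p (UNIV \<times> {js. pmf (iid_pmf n label_pmf) js > 2 powr (n * (Ll + \<delta>))})"
      by (intro measure_pmf.finite_measure_mono_AE AE_pmfI)
         (auto simp: p_def c_def pmf_pair set_key_pmf pmf_key_pmf divide_less_cancel)
    also have "\<dots> = measure_pmf.prob (iid_pmf n label_pmf) {js. pmf (iid_pmf n label_pmf) js > 2 powr (n * (Ll + \<delta>))}"
      by (simp add: p_def prob_pair_pmf_Times measure_pmf.prob_space[simplified])
    also have "\<dots> = measure_pmf.prob ?I {t. pmf (iid_pmf n label_pmf) (map (\<psi> \<circ> to_z) t) > 2 powr (n * (Ll + \<delta>))}"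
      by (subst (1) label_pmf_def, subst map_iid_pmf[symmetric]) (simp add: vimage_def)
    also have "\<dots> = measure_pmf.prob ?I {t. prod_list (map dens_label t) > 2 powr (n * (Ll + \<delta>))}"
      by (intro measure_pmf.finite_measure_eq_AE AE_pmfI)
         (auto simp: set_iid_pmf pmf_iid_pmf dens_label_def[abs_def] o_def)
    also have "\<dots> \<le> measure_pmf.expectation P (\<lambda>w. (log 2 (dens_label w) - Ll)\<^sup>2) / (n * \<delta>\<^sup>2)"
      using n \<delta> by (intro aep_upper) (auto simp: Ll_def dens_pos)
    finally show ?thesis .
  qed
  ultimately show ?thesis unfolding M_def c_def by linarith
qed

lemma converse:
  assumes "merging_achievable P PE R"
  shows "rate \<le> R"
proof (rule field_le_epsilon)
  fix e :: real assume "e > 0"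
  \<comment> \<open>The two typicality slacks add up to \<open>e\<close>.\<close>
  define \<delta> where "\<delta> = e / 2"
  have \<delta>: "\<delta> > 0" using \<open>e > 0\<close> by (simp add: \<delta>_def)
  obtain k l prot Q where
    err: "(\<lambda>n. merge_error P PE n (k n) (l n) (prot n) (Q n)) \<longlonglongrightarrow> 0" and
    lim: "(\<lambda>n. (real (k n) - real (l n)) / real n) \<longlonglongrightarrow> R"
    using assms unfolding merging_achievable_def by blast
  define Ly where "Ly = measure_pmf.expectation P (\<lambda>w. log 2 (dens_y w))"
  define Ll where "Ll = measure_pmf.expectation P (\<lambda>w. log 2 (dens_label w))"
  define V1 where "V1 = measure_pmf.expectation P (\<lambda>w. (log 2 (dens_y w) - Ly)\<^sup>2)"
  define V2 where "V2 = measure_pmf.expectation P (\<lambda>w. (log 2 (dens_label w) - Ll)\<^sup>2)"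
  have rate: "Ly + Ll = - rate" unfolding Ly_def Ll_def by (rule expectation_log_dens)
  have sum_eq: "Ly + Ll + 2 * \<delta> = e - rate" using rate by (simp add: \<delta>_def)
  have tend: "(\<lambda>n. V / (real n * \<delta>\<^sup>2)) \<longlonglongrightarrow> 0" for V :: real
    using lim_const_over_n[of "V / \<delta>\<^sup>2"] by (simp add: mult.commute)
  have "(\<lambda>n. 1 - merge_error P PE n (k n) (l n) (prot n) (Q n) - V1 / (real n * \<delta>\<^sup>2) - V2 / (real n * \<delta>\<^sup>2)) \<longlonglongrightarrow> 1 - 0 - 0 - 0"
    by (intro tendsto_diff err tend tendsto_const)
  \<comment> \<open>Any constant strictly between 0 and 1 would serve. The value 1/2 under the
    square root becomes the exponent -2, the source of the vanishing loss
    \<open>2 / real n\<close>.\<close>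
  then have ev: "\<forall>\<^sub>F n in sequentially. 1 / 2 <
      1 - merge_error P PE n (k n) (l n) (prot n) (Q n) - V1 / (real n * \<delta>\<^sup>2) - V2 / (real n * \<delta>\<^sup>2)"
    by (rule order_tendstoD) simp
  have bound: "\<forall>\<^sub>F n in sequentially. rate - e - 2 / real n \<le> (real (k n) - real (l n)) / real n"
    using ev eventually_gt_at_top[of 0]
  proof eventually_elim
    case (elim n)
    let ?x = "real (k n) - real (l n) + n * (Ly + Ll + 2 * \<delta>)"
    have "(2 ^ k n * 2 powr (n * (Ly + \<delta>))) * ((1 / 2 ^ l n) * 2 powr (n * (Ll + \<delta>)))
       = (2 powr real (k n) * 2 powr (n * (Ly + \<delta>))) * (2 powr (- real (l n)) * 2 powr (n * (Ll + \<delta>)))"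
      by (simp add: powr_realpow powr_minus divide_inverse)
    also have "\<dots> = 2 powr ?x"
      by (simp add: algebra_simps flip: powr_add)
    finally have eq: "(2 ^ k n * 2 powr (n * (Ly + \<delta>))) * ((1 / 2 ^ l n) * 2 powr (n * (Ll + \<delta>))) = 2 powr ?x" .
    have "1 - merge_error P PE n (k n) (l n) (prot n) (Q n) - V1 / (real n * \<delta>\<^sup>2) - V2 / (real n * \<delta>\<^sup>2)
       \<le> sqrt (2 powr ?x)"
      using converse_one_shot[OF elim(2) \<delta>, of PE "k n" "l n" "prot n" "Q n"]
      unfolding Ly_def[symmetric] Ll_def[symmetric] V1_def[symmetric] V2_def[symmetric] eq .
    with elim(1) have "1 / 2 < sqrt (2 powr ?x)" by linarith
    then have "(1 / 2)\<^sup>2 < (sqrt (2 powr ?x))\<^sup>2" by (intro power_strict_mono) auto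
    then have "(1 / 2)\<^sup>2 < 2 powr ?x" by simp
    then have "2 powr (- 2) < 2 powr ?x" by (simp add: powr_minus power2_eq_square)
    then have "- 2 < ?x" by (subst (asm) powr_less_cancel_iff) auto
    then have "n * (rate - e) - 2 < real (k n) - real (l n)"
      unfolding sum_eq by (simp add: algebra_simps)
    then show ?case using elim(2) by (subst pos_le_divide_eq) (auto simp: algebra_simps)
  qed
  have "(\<lambda>n. rate - e - 2 / real n) \<longlonglongrightarrow> rate - e - 0"
    by (intro tendsto_diff tendsto_const lim_const_over_n)
  then have "(\<lambda>n. rate - e - 2 / real n) \<longlonglongrightarrow> rate - e" by simp
  from tendsto_le[OF _ lim this bound] show "rate \<le> R + e" by simp
qed

end

section \<open>Coding for independent copies\<close>

definition xor_list :: "bool list \<Rightarrow> bool list \<Rightarrow> bool list" where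
  "xor_list = map2 (\<noteq>)"

lemma length_xor_list [simp]: "length (xor_list xs ys) = min (length xs) (length ys)"
  by (simp add: xor_list_def)

lemma xor_list_cancel: "length xs = length ys \<Longrightarrow> xor_list (xor_list xs ys) ys = xs"
  unfolding xor_list_def by (induction xs ys rule: list_induct2) auto

lemma xor_list_cancel_left: "length xs = length ys \<Longrightarrow> xor_list xs (xor_list xs ys) = ys"
  unfolding xor_list_def by (induction xs ys rule: list_induct2) auto

lemma one_time_pad:
  assumes "length m = k" shows "map_pmf (xor_list m) (key_pmf k) = key_pmf k"
  unfolding key_pmf_def
proof (rule map_pmf_of_set_bij_betw[OF _ bool_lists_nonempty finite_bool_lists])
  show "bij_betw (xor_list m) {ks. length ks = k} {ks. length ks = k}"
    by (rule bij_betw_byWitness[where f' = "xor_list m"]) (use assms in \<open>auto simp: xor_list_cancel_left\<close>)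
qed

text \<open>Local randomness is one number drawn before any data is known, whereas Bob's output law
  depends on the decoded labels. The seed therefore packs an independent sample for each of the
  finitely many cases, and Bob reads the one that applies.\<close>

lemma kernel_from_seed:
  fixes L :: "'a \<Rightarrow> 'b::countable pmf"
  assumes "finite D"
  obtains r :: "nat pmf" and F :: "'a \<Rightarrow> nat \<Rightarrow> 'b" where "\<And>x. x \<in> D \<Longrightarrow> map_pmf (F x) r = L x"
proof -
  have "\<exists>(r :: nat pmf) F. \<forall>x\<in>D. map_pmf (F x) r = L x"
    using assms
  proof (induction D)
    case (insert y D)
    then obtain r :: "nat pmf" and F where F: "\<forall>x\<in>D. map_pmf (F x) r = L x" by blast
    let ?r = "map_pmf prod_encode (pair_pmf (map_pmf to_nat (L y)) r)"
    let ?F = "\<lambda>x s. if x = y then from_nat (fst (prod_decode s)) else F x (snd (prod_decode s))"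
    have "map_pmf (?F y) ?r = map_pmf (from_nat \<circ> to_nat) (map_pmf fst (pair_pmf (L y) r))"
      unfolding pair_map_pmf1 by (simp add: map_pmf_comp o_def)
    then have F1: "map_pmf (?F y) ?r = L y" by (simp add: map_fst_pair_pmf o_def)
    have F2: "map_pmf (?F x) ?r = L x" if "x \<in> D" for x
    proof -
      have "x \<noteq> y" using that insert by auto
      then have "map_pmf (?F x) ?r = map_pmf (F x) (map_pmf snd (pair_pmf (map_pmf to_nat (L y)) r))"
        by (simp add: map_pmf_comp)
      then show ?thesis using F that by (simp add: map_snd_pair_pmf)
    qed
    have "map_pmf (?F x) ?r = L x" if "x \<in> insert y D" for x
    proof (cases "x = y")
      case True
      show ?thesis unfolding True by (rule F1)
    next
      case False
      with that have "x \<in> D" by simp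
      then show ?thesis by (rule F2)
    qed
    then show ?case by (intro exI[of _ ?r] exI[of _ ?F] ballI)
  qed simp
  then show ?thesis using that by blast
qed

section \<open>Block codes from the one-shot bounds\<close>

definition unzip_pmf :: "nat \<Rightarrow> ('a \<times> 'b) pmf \<Rightarrow> ('a list \<times> 'b list) pmf" where
  "unzip_pmf n q = map_pmf (\<lambda>ws. (map fst ws, map snd ws)) (iid_pmf n q)"

lemma map_snd_unzip_pmf: "map_pmf snd (unzip_pmf n q) = iid_pmf n (map_pmf snd q)"
  by (simp add: unzip_pmf_def map_pmf_comp flip: map_iid_pmf)

lemma pmf_unzip_pmf: "pmf (unzip_pmf n q) (map fst ws, map snd ws) = pmf (iid_pmf n q) ws"
  unfolding unzip_pmf_def
proof (rule pmf_map_inj')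
  show "inj (\<lambda>ws. (map fst ws, map snd ws))"
    by (rule inj_on_inverseI[of _ "\<lambda>(xs, ys). zip xs ys"]) (simp add: zip_map_fst_snd)
qed

lemma pmf_unzip_cond_density:
  assumes "ws \<in> set_pmf (iid_pmf n q)"
  shows "pmf (unzip_pmf n q) (map fst ws, map snd ws)
     = prod_list (map (cond_density q) ws) * pmf (map_pmf snd (unzip_pmf n q)) (map snd ws)"
    and "pmf (map_pmf snd (unzip_pmf n q)) (map snd ws) > 0"
proof -
  have ws: "length ws = n" "set ws \<subseteq> set_pmf q" using assms by (auto simp: set_iid_pmf)
  have "prod_list (map (pmf q) ws) = prod_list (map (cond_density q) ws) * prod_list (map (pmf (map_pmf snd q)) (map snd ws))
    \<and> prod_list (map (pmf (map_pmf snd q)) (map snd ws)) > 0"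
    using ws(2)
  proof (induction ws)
    case (Cons w ws)
    then have "pmf (map_pmf snd q) (snd w) > 0" by (intro pmf_map_pos) auto
    with Cons show ?case by (auto simp: cond_density_def)
  qed auto
  then show "pmf (unzip_pmf n q) (map fst ws, map snd ws)
     = prod_list (map (cond_density q) ws) * pmf (map_pmf snd (unzip_pmf n q)) (map snd ws)"
    and "pmf (map_pmf snd (unzip_pmf n q)) (map snd ws) > 0"
    unfolding pmf_unzip_pmf map_snd_unzip_pmf using ws(1) by (simp_all add: pmf_iid_pmf)
qed

text \<open>Here \<open>h\<close> is minus the conditional entropy. With threshold
  \<open>2 powr (n * (h - \<delta>))\<close>, all but a Chebyshev tail of the pairs are
  typical.\<close>

lemma slepian_wolf_iid:
  fixes q :: "('a::finite \<times> 'b::finite) pmf"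
  assumes n: "n > 0" and \<delta>: "\<delta> > 0" and h: "h = measure_pmf.expectation q (\<lambda>w. log 2 (cond_density q w))"
  obtains f :: "'a list \<Rightarrow> bool list" and d where "\<And>xs. length (f xs) = k"
    "measure_pmf.prob (iid_pmf n q) {ws. d (f (map fst ws)) (map snd ws) \<noteq> map fst ws}
     \<le> measure_pmf.expectation q (\<lambda>w. (log 2 (cond_density q w) - h)\<^sup>2) / (n * \<delta>\<^sup>2)
       + 1 / (2 powr (n * (h - \<delta>)) * 2 ^ k)"
proof -
  let ?p = "unzip_pmf n q" and ?\<theta> = "2 powr (n * (h - \<delta>))"
  have fin: "finite (set_pmf ?p)" by (simp add: unzip_pmf_def finite_set_iid_pmf)
  have pos: "?\<theta> > 0" by simp
  obtain f :: "'a list \<Rightarrow> bool list" and d where f: "\<And>x. f x \<in> {ks. length ks = k}"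
    and d: "measure_pmf.prob ?p {(x, y). d (f x) y \<noteq> x}
     \<le> measure_pmf.prob ?p {(x, y). pmf ?p (x, y) < ?\<theta> * pmf (map_pmf snd ?p) y} + 1 / (?\<theta> * card {ks :: bool list. length ks = k})"
    by (rule slepian_wolf_one_shot[OF fin finite_bool_lists bool_lists_nonempty[of k] pos]; rule that; assumption)
  have "measure_pmf.prob ?p {(x, y). pmf ?p (x, y) < ?\<theta> * pmf (map_pmf snd ?p) y}
     = measure_pmf.prob (iid_pmf n q) {ws. pmf ?p (map fst ws, map snd ws) < ?\<theta> * pmf (map_pmf snd ?p) (map snd ws)}"
    by (subst (1) unzip_pmf_def) (simp add: vimage_def)
  also have "\<dots> = measure_pmf.prob (iid_pmf n q) {ws. prod_list (map (cond_density q) ws) < ?\<theta>}"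
    by (intro measure_pmf.finite_measure_eq_AE AE_pmfI)
       (auto simp: pmf_unzip_cond_density mult_less_cancel_right_pos)
  also have "\<dots> \<le> measure_pmf.expectation q (\<lambda>w. (log 2 (cond_density q w) - h)\<^sup>2) / (n * \<delta>\<^sup>2)"
    using n \<delta> h by (intro aep_lower) (auto simp: cond_density_pos)
  finally have "measure_pmf.prob ?p {(x, y). d (f x) y \<noteq> x}
    \<le> measure_pmf.expectation q (\<lambda>w. (log 2 (cond_density q w) - h)\<^sup>2) / (n * \<delta>\<^sup>2) + 1 / (?\<theta> * 2 ^ k)"
    using d by (simp add: card_bool_lists)
  then show ?thesis using f that[of f d] by (simp add: unzip_pmf_def vimage_def)
qed

text \<open>The empty key is exact and treated apart: for \<open>l = 0\<close> the square root need
  not be small, for instance when \<open>h\<close> is 0.\<close>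

lemma privacy_amplification_iid:
  fixes q :: "('a::finite \<times> 'b::finite) pmf"
  assumes n: "n > 0" and \<delta>: "\<delta> > 0" and h: "h = measure_pmf.expectation q (\<lambda>w. log 2 (cond_density q w))"
  obtains g :: "'a list \<Rightarrow> bool list" where
    "l1_dist (map_pmf (\<lambda>ws. (g (map fst ws), map snd ws)) (iid_pmf n q)) (pair_pmf (key_pmf l) (iid_pmf n (map_pmf snd q)))
     \<le> (if l = 0 then 0 else 2 * (measure_pmf.expectation q (\<lambda>w. (log 2 (cond_density q w) - h)\<^sup>2) / (n * \<delta>\<^sup>2))
       + sqrt (2 ^ l * 2 powr (n * (h + \<delta>))))"
proof (cases "l = 0")
  case True
  have "key_pmf 0 = return_pmf []" by (simp add: key_pmf_def pmf_of_set_singleton)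
  then have "map_pmf (\<lambda>ws. ([], map snd ws)) (iid_pmf n q) = pair_pmf (key_pmf 0) (iid_pmf n (map_pmf snd q))"
    by (simp add: pair_return_pmf1 map_pmf_comp flip: map_iid_pmf)
  then show ?thesis using True that[of "\<lambda>_. []"] by simp
next
  case False
  let ?p = "unzip_pmf n q" and ?\<theta> = "2 powr (n * (h + \<delta>))"
  have fin: "finite (set_pmf ?p)" by (simp add: unzip_pmf_def finite_set_iid_pmf)
  have pos: "?\<theta> > 0" by simp
  obtain g :: "'a list \<Rightarrow> bool list" where "\<And>x. g x \<in> {ks. length ks = l}" and
    g: "l1_dist (map_pmf (\<lambda>(x, z). (g x, z)) ?p) (pair_pmf (pmf_of_set {ks. length ks = l}) (map_pmf snd ?p))
     \<le> 2 * measure_pmf.prob ?p {(x, z). pmf ?p (x, z) > ?\<theta> * pmf (map_pmf snd ?p) z} + sqrt (card {ks :: bool list. length ks = l} * ?\<theta>)"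
    by (rule privacy_amplification_one_shot[OF fin finite_bool_lists bool_lists_nonempty[of l] pos]; rule that; assumption)
  have "measure_pmf.prob ?p {(x, z). pmf ?p (x, z) > ?\<theta> * pmf (map_pmf snd ?p) z}
     = measure_pmf.prob (iid_pmf n q) {ws. pmf ?p (map fst ws, map snd ws) > ?\<theta> * pmf (map_pmf snd ?p) (map snd ws)}"
    by (subst (1) unzip_pmf_def) (simp add: vimage_def)
  also have "\<dots> = measure_pmf.prob (iid_pmf n q) {ws. prod_list (map (cond_density q) ws) > ?\<theta>}"
    by (intro measure_pmf.finite_measure_eq_AE AE_pmfI)
       (auto simp: pmf_unzip_cond_density mult_less_cancel_right_pos)
  also have "\<dots> \<le> measure_pmf.expectation q (\<lambda>w. (log 2 (cond_density q w) - h)\<^sup>2) / (n * \<delta>\<^sup>2)"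
    using n \<delta> h by (intro aep_upper) (auto simp: cond_density_pos)
  finally have bad: "measure_pmf.prob ?p {(x, z). pmf ?p (x, z) > ?\<theta> * pmf (map_pmf snd ?p) z}
     \<le> measure_pmf.expectation q (\<lambda>w. (log 2 (cond_density q w) - h)\<^sup>2) / (n * \<delta>\<^sup>2)" .
  have "map_pmf (\<lambda>(x, z). (g x, z)) ?p = map_pmf (\<lambda>ws. (g (map fst ws), map snd ws)) (iid_pmf n q)"
    by (simp add: unzip_pmf_def map_pmf_comp)
  then show ?thesis
    using g bad False that[of g] by (simp add: card_bool_lists map_snd_unzip_pmf key_pmf_def)
qed

section \<open>Merging protocol\<close>

context bi_disjoint_source
begin

text \<open>Given the labels of Z^n, a fresh draw of the XY block has the same joint law with Z^n as
  the original one. This is what entitles Bob to discard the true block.\<close>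

lemma iid_resample:
  "map_pmf (\<lambda>t. (map to_xy t, map to_z t)) (iid_pmf n P)
   = do {zs \<leftarrow> iid_pmf n (map_pmf to_z P); th \<leftarrow> list_kernel K (map \<psi> zs); return_pmf (th, zs)}"
proof -
  have "map_pmf (\<lambda>t. (map to_xy t, map to_z t)) (list_kernel (\<lambda>z. map_pmf (\<lambda>(x, y). (x, y, z)) (K (\<psi> z))) zs)
     = map_pmf (\<lambda>th. (th, zs)) (list_kernel (\<lambda>z. K (\<psi> z)) zs)" for zs
  proof (induction zs)
    case (Cons z zs)
    let ?L = "\<lambda>z. map_pmf (\<lambda>(x, y). (x, y, z)) (K (\<psi> z))"
    have "map_pmf (\<lambda>t. (map to_xy t, map to_z t)) (list_kernel ?L (z # zs))
      = do {w \<leftarrow> K (\<psi> z); r \<leftarrow> map_pmf (\<lambda>t. (map to_xy t, map to_z t)) (list_kernel ?L zs);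
            return_pmf (w # fst r, z # snd r)}"
      by (simp add: map_bind_pmf bind_map_pmf case_prod_unfold)
    then show ?case unfolding Cons.IH by (simp add: map_bind_pmf bind_map_pmf)
  qed simp
  moreover have "P = bind_pmf (map_pmf to_z P) (\<lambda>z. map_pmf (\<lambda>(x, y). (x, y, z)) (K (\<psi> z)))"
    by (subst source_eq_bind) (simp add: map_pmf_def case_prod_unfold)
  then have "iid_pmf n P = bind_pmf (iid_pmf n (map_pmf to_z P))
      (list_kernel (\<lambda>z. map_pmf (\<lambda>(x, y). (x, y, z)) (K (\<psi> z))))"
    by (metis iid_pmf_bind)
  ultimately show ?thesis
    by (simp add: map_bind_pmf map_pmf_def[symmetric] list_kernel_map)
qed

text \<open>The seed \<open>r\<close> is Bob's local randomness for resampling \<open>(X, Y)\<close>.  He must not output the decoded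
  \<open>X\<close>, since the key \<open>g X\<close> would be correlated with it.\<close>

lemma merging_one_shot:
  fixes f g :: "'x list \<Rightarrow> bool list" and PE :: "'e pmf"
  assumes f: "\<And>xs. length (f xs) = k"
  shows "\<exists>prot Q. merge_error P PE n k l prot Q
     \<le> 2 * measure_pmf.prob (iid_pmf n (map_pmf to_xy P)) {ws. d (f (map fst ws)) (map snd ws) \<noteq> map fst ws}
       + l1_dist (map_pmf (\<lambda>ws. (g (map fst ws), map snd ws)) (iid_pmf n (map_pmf to_xz P)))
           (pair_pmf (key_pmf l) (iid_pmf n (map_pmf snd (map_pmf to_xz P))))"
proof -
  let ?I = "iid_pmf n P"
  define D where "D = (\<lambda>t. map (\<psi> \<circ> to_z) t) ` set_pmf ?I"
  have "finite D" by (simp add: D_def finite_set_iid_pmf)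
  then obtain r :: "nat pmf" and F where F: "\<And>js. js \<in> D \<Longrightarrow> map_pmf (F js) r = list_kernel K js"
    using kernel_from_seed[where L = "list_kernel K"] by metis
  define prot :: "('x, 'y) lopc" where "prot = \<lparr>randA = return_pmf 0, randB = r, nrounds = 1,
    msgA = (\<lambda>xs key a \<tau>. to_nat (xor_list (f xs) key)), msgB = (\<lambda>ys key b \<tau>. 0),
    outA = (\<lambda>xs key a \<tau>. g xs),
    outB = (\<lambda>ys key b \<tau>. let xs = d (xor_list (from_nat (hd \<tau>)) key) ys in (g xs, F (map \<phi> (zip xs ys)) b))\<rparr>"
  \<comment> \<open>By the one-time pad the ciphertext is uniform whatever the source block
    is.\<close>
  define Q where "Q = map_pmf (\<lambda>m. [to_nat (m :: bool list)]) (key_pmf k)"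
  define real_run where "real_run t = do {es \<leftarrow> iid_pmf n PE; key \<leftarrow> key_pmf k; b \<leftarrow> r;
     let xs = map fst t; ys = map to_y t; xs' = d (xor_list (xor_list (f xs) key) key) ys
     in return_pmf (g xs, (g xs', F (map \<phi> (zip xs' ys)) b), map to_z t, es, [to_nat (xor_list (f xs) key)])}"
    for t :: "('x \<times> 'y \<times> 'z) list"
  \<comment> \<open>Bob's decoded block is replaced by the true one, so this run departs from the
    real one only on decoding errors.\<close>
  define ideal_run where "ideal_run t = do {es \<leftarrow> iid_pmf n PE; key \<leftarrow> key_pmf k; b \<leftarrow> r;
     return_pmf (g (map fst t), (g (map fst t), F (map (\<psi> \<circ> to_z) t) b), map to_z t, es, [to_nat (xor_list (f (map fst t)) key)])}"
    for t :: "('x \<times> 'y \<times> 'z) list"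
  \<comment> \<open>Everything that remains random once the extracted key and Z^n are given. The
    ideal run and the target both apply \<open>G\<close>, so their distance is at most that of its
    inputs, which privacy amplification bounds.\<close>
  define G where "G = (\<lambda>(u :: bool list, zs). do {es \<leftarrow> iid_pmf n PE; m \<leftarrow> key_pmf k; th \<leftarrow> list_kernel K (map \<psi> zs);
     return_pmf (u, (u, th), zs, es, [to_nat m])})"
  let ?GZ = "map_pmf (\<lambda>ws. (g (map fst ws), map snd ws)) (iid_pmf n (map_pmf to_xz P))"
  let ?UZ = "pair_pmf (key_pmf l) (iid_pmf n (map_pmf snd (map_pmf to_xz P)))"
  have proj: "to_y = (fst \<circ> snd :: 'x \<times> 'y \<times> 'z \<Rightarrow> 'y)" "to_z = (snd \<circ> snd :: 'x \<times> 'y \<times> 'z \<Rightarrow> 'z)"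
    by (simp_all add: fun_eq_iff case_prod_unfold)
  have run: "lopc_output P PE n k prot = bind_pmf ?I real_run"
    unfolding lopc_output_def real_run_def prot_def by (simp add: Let_def bind_return_pmf proj)
  have labels: "map \<phi> (zip (map fst t) (map to_y t)) = map (\<psi> \<circ> to_z) t" if "t \<in> set_pmf ?I" for t
  proof -
    have "zip (map fst t) (map to_y t) = map to_xy t" by (induction t) auto
    moreover have "\<phi> (to_xy w) = \<psi> (to_z w)" if "w \<in> set_pmf P" for w
      using label that by (cases w) auto
    ultimately show ?thesis using that by (auto simp: set_iid_pmf)
  qed
  have real_ideal: "l1_dist (bind_pmf ?I real_run) (bind_pmf ?I ideal_run)
     \<le> 2 * measure_pmf.prob ?I {t. d (f (map fst t)) (map to_y t) \<noteq> map fst t}"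
  proof (rule l1_dist_bind_kernels_le)
    fix t assume t: "t \<in> set_pmf ?I" and "t \<notin> {t. d (f (map fst t)) (map to_y t) \<noteq> map fst t}"
    then have dec: "d (f (map fst t)) (map to_y t) = map fst t" by simp
    have "xor_list (xor_list (f (map fst t)) key) key = f (map fst t)" if "key \<in> set_pmf (key_pmf k)" for key
      using that f by (intro xor_list_cancel) (simp add: set_key_pmf)
    then show "real_run t = ideal_run t"
      unfolding real_run_def ideal_run_def
      by (intro bind_pmf_cong refl) (simp add: Let_def dec labels[OF t, simplified])
  qed
  have ideal: "bind_pmf ?I ideal_run = bind_pmf ?GZ G"
  proof -
    have "bind_pmf ?I ideal_run = bind_pmf ?I (\<lambda>t. G (g (map fst t), map to_z t))"
    proof (rule bind_pmf_cong[OF refl])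
      fix t assume "t \<in> set_pmf ?I"
      then have js: "map (\<psi> \<circ> to_z) t \<in> D" by (auto simp: D_def)
      have "ideal_run t = do {es \<leftarrow> iid_pmf n PE; m \<leftarrow> map_pmf (xor_list (f (map fst t))) (key_pmf k);
         th \<leftarrow> map_pmf (F (map (\<psi> \<circ> to_z) t)) r;
         return_pmf (g (map fst t), (g (map fst t), th), map to_z t, es, [to_nat m])}"
        by (simp add: ideal_run_def bind_map_pmf)
      then show "ideal_run t = G (g (map fst t), map to_z t)"
        unfolding one_time_pad[OF f] F[OF js] by (simp add: G_def)
    qed
    also have "\<dots> = bind_pmf (map_pmf (\<lambda>t. (g (map fst t), map to_z t)) ?I) G"
      by (simp add: bind_map_pmf)
    also have "map_pmf (\<lambda>t. (g (map fst t), map to_z t)) ?I = ?GZ"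
      by (simp add: map_pmf_comp o_def case_prod_unfold flip: map_iid_pmf)
    finally show ?thesis .
  qed
  have target: "merge_target P PE n l Q = bind_pmf ?UZ G"
  proof -
    have "merge_target P PE n l Q
       = do {w \<leftarrow> map_pmf (\<lambda>t. (map to_xy t, map to_z t)) ?I; es \<leftarrow> iid_pmf n PE; u \<leftarrow> key_pmf l; m \<leftarrow> key_pmf k;
             return_pmf (u, (u, fst w), snd w, es, [to_nat m])}"
      by (simp add: merge_target_def Q_def bind_map_pmf proj)
    also have "\<dots> = do {zs \<leftarrow> iid_pmf n (map_pmf to_z P); th \<leftarrow> list_kernel K (map \<psi> zs); es \<leftarrow> iid_pmf n PE;
         u \<leftarrow> key_pmf l; m \<leftarrow> key_pmf k; return_pmf (u, (u, th), zs, es, [to_nat m])}"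
      unfolding iid_resample by (simp add: bind_assoc_pmf bind_return_pmf)
    also have "\<dots> = do {zs \<leftarrow> iid_pmf n (map_pmf to_z P); u \<leftarrow> key_pmf l; th \<leftarrow> list_kernel K (map \<psi> zs); es \<leftarrow> iid_pmf n PE;
         m \<leftarrow> key_pmf k; return_pmf (u, (u, th), zs, es, [to_nat m])}"
      by (intro bind_pmf_cong refl) (subst (2) bind_commute_pmf, subst bind_commute_pmf, rule refl)
    also have "\<dots> = do {zs \<leftarrow> iid_pmf n (map_pmf to_z P); u \<leftarrow> key_pmf l; G (u, zs)}"
      unfolding G_def prod.case
      by (intro bind_pmf_cong refl) (subst bind_commute_pmf, subst (2) bind_commute_pmf, rule refl)
    also have "\<dots> = do {u \<leftarrow> key_pmf l; zs \<leftarrow> iid_pmf n (map_pmf to_z P); G (u, zs)}"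
      by (rule bind_commute_pmf)
    also have "\<dots> = bind_pmf ?UZ G"
      by (simp add: pair_pmf_def bind_assoc_pmf bind_return_pmf map_pmf_comp case_prod_unfold)
    finally show ?thesis .
  qed
  have "merge_error P PE n k l prot Q \<le> l1_dist (bind_pmf ?I real_run) (bind_pmf ?I ideal_run) + l1_dist (bind_pmf ?GZ G) (bind_pmf ?UZ G)"
    unfolding merge_error_def run target ideal[symmetric] by (rule l1_dist_triangle)
  also have "\<dots> \<le> 2 * measure_pmf.prob ?I {t. d (f (map fst t)) (map to_y t) \<noteq> map fst t} + l1_dist ?GZ ?UZ"
    by (intro add_mono real_ideal l1_dist_bind_le)
  also have "measure_pmf.prob ?I {t. d (f (map fst t)) (map to_y t) \<noteq> map fst t}
     = measure_pmf.prob (iid_pmf n (map_pmf to_xy P)) {ws. d (f (map fst ws)) (map snd ws) \<noteq> map fst ws}"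
    by (simp add: vimage_def o_def case_prod_unfold flip: map_iid_pmf)
  finally show ?thesis by blast
qed

lemma achievability:
  fixes PE :: "'e pmf"
  shows "merging_achievable P PE rate"
proof -
  let ?XY = "map_pmf to_xy P" and ?XZ = "map_pmf to_xz P"
  define h1 where "h1 = measure_pmf.expectation ?XY (\<lambda>w. log 2 (cond_density ?XY w))"
  define h2 where "h2 = measure_pmf.expectation ?XZ (\<lambda>w. log 2 (cond_density ?XZ w))"
  define V1 where "V1 = measure_pmf.expectation ?XY (\<lambda>w. (log 2 (cond_density ?XY w) - h1)\<^sup>2)"
  define V2 where "V2 = measure_pmf.expectation ?XZ (\<lambda>w. (log 2 (cond_density ?XZ w) - h2)\<^sup>2)"
  have rate: "rate = h2 - h1" unfolding h1_def h2_def by (rule expectation_log_dens(2)[symmetric])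
  have h_le: "measure_pmf.expectation q (\<lambda>w. log 2 (cond_density q w)) \<le> 0" for q :: "('a \<times> 'b) pmf"
  proof -
    have "0 \<le> measure_pmf.expectation q (\<lambda>w. - log 2 (cond_density q w))"
      by (rule integral_nonneg_AE, rule AE_pmfI) (simp add: cond_density_pos cond_density_le_1)
    then show ?thesis by simp
  qed
  have h: "h1 \<le> 0" "h2 \<le> 0" unfolding h1_def h2_def by (rule h_le)+
  have V2: "V2 \<ge> 0" unfolding V2_def by (rule integral_nonneg_AE) simp
  \<comment> \<open>The slack tends to 0, yet n times its square grows like the square root of n, so
    the Chebyshev terms vanish as well.\<close>
  define \<delta> where "\<delta> n = real n powr (- 1 / 4)" for n
  \<comment> \<open>One \<delta> pays for the typicality threshold; the other leaves the collision
    term at \<open>2 powr (- (n * \<delta> n))\<close>.\<close>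
  define k where "k n = nat \<lceil>n * (- h1 + 2 * \<delta> n)\<rceil>" for n
  \<comment> \<open>The two \<delta> play the same roles for extraction. \<open>nat\<close> turns a
    negative length into 0, where the exact empty key applies.\<close>
  define l where "l n = nat \<lfloor>n * (- h2 - 2 * \<delta> n)\<rfloor>" for n
  define bound where "bound n = 2 * (V1 / (n * (\<delta> n)\<^sup>2) + 2 powr (- (n * \<delta> n))) + (2 * (V2 / (n * (\<delta> n)\<^sup>2)) + sqrt (2 powr (- (n * \<delta> n))))" for n
  have "\<exists>prot Q. merge_error P PE n (k n) (l n) prot Q \<le> bound n" if n: "n > 0" for n
  proof -
    have \<delta>: "\<delta> n > 0" using n by (simp add: \<delta>_def)
    obtain f :: "'x list \<Rightarrow> bool list" and d where f: "\<And>xs. length (f xs) = k n"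
      and d: "measure_pmf.prob (iid_pmf n ?XY) {ws. d (f (map fst ws)) (map snd ws) \<noteq> map fst ws}
         \<le> V1 / (n * (\<delta> n)\<^sup>2) + 1 / (2 powr (n * (h1 - \<delta> n)) * 2 ^ k n)"
      by (rule slepian_wolf_iid[OF n \<delta> h1_def, where k = "k n", folded V1_def]; rule that; assumption)
    obtain g :: "'x list \<Rightarrow> bool list" where
      g: "l1_dist (map_pmf (\<lambda>ws. (g (map fst ws), map snd ws)) (iid_pmf n ?XZ)) (pair_pmf (key_pmf (l n)) (iid_pmf n (map_pmf snd ?XZ)))
        \<le> (if l n = 0 then 0 else 2 * (V2 / (n * (\<delta> n)\<^sup>2)) + sqrt (2 ^ l n * 2 powr (n * (h2 + \<delta> n))))"
      by (rule privacy_amplification_iid[OF n \<delta> h2_def, where l = "l n", folded V2_def]; rule that; assumption)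
    have "n * \<delta> n \<le> n * (h1 - \<delta> n) + k n"
      unfolding k_def using le_of_int_ceiling[of "n * (- h1 + 2 * \<delta> n)"] by (simp add: algebra_simps) linarith
    then have "2 powr (n * \<delta> n) \<le> 2 powr (n * (h1 - \<delta> n)) * 2 ^ k n"
      by (simp flip: powr_add powr_realpow)
    then have "1 / (2 powr (n * (h1 - \<delta> n)) * 2 ^ k n) \<le> 1 / 2 powr (n * \<delta> n)"
      by (intro divide_left_mono) auto
    then have d': "1 / (2 powr (n * (h1 - \<delta> n)) * 2 ^ k n) \<le> 2 powr (- (n * \<delta> n))"
      by (simp add: powr_minus divide_inverse)
    have g': "(if l n = 0 then 0 else 2 * (V2 / (n * (\<delta> n)\<^sup>2)) + sqrt (2 ^ l n * 2 powr (n * (h2 + \<delta> n))))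
       \<le> 2 * (V2 / (n * (\<delta> n)\<^sup>2)) + sqrt (2 powr (- (n * \<delta> n)))"
    proof (cases "l n = 0")
      case False
      then have "real (l n) \<le> n * (- h2 - 2 * \<delta> n)" unfolding l_def by linarith
      then have "l n + n * (h2 + \<delta> n) \<le> - (n * \<delta> n)" by (simp add: algebra_simps)
      then have "2 ^ l n * 2 powr (n * (h2 + \<delta> n)) \<le> 2 powr (- (n * \<delta> n))"
        by (simp flip: powr_add powr_realpow)
      then show ?thesis using False by simp
    qed (use V2 in simp)
    obtain prot :: "('x, 'y) lopc" and Q where "merge_error P PE n (k n) (l n) prot Q
       \<le> 2 * measure_pmf.prob (iid_pmf n ?XY) {ws. d (f (map fst ws)) (map snd ws) \<noteq> map fst ws}
         + l1_dist (map_pmf (\<lambda>ws. (g (map fst ws), map snd ws)) (iid_pmf n ?XZ)) (pair_pmf (key_pmf (l n)) (iid_pmf n (map_pmf snd ?XZ)))"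
      using merging_one_shot[of f "k n" PE n "l n" d g, OF f] by blast
    with d d' g g' have "merge_error P PE n (k n) (l n) prot Q \<le> bound n"
      unfolding bound_def by argo
    then show ?thesis by blast
  qed
  then obtain prot :: "nat \<Rightarrow> ('x, 'y) lopc" and Q where
    err: "\<And>n. n > 0 \<Longrightarrow> merge_error P PE n (k n) (l n) (prot n) (Q n) \<le> bound n"
    by metis
  have "bound \<longlonglongrightarrow> 0"
    unfolding bound_def \<delta>_def by real_asymp
  then have "(\<lambda>n. merge_error P PE n (k n) (l n) (prot n) (Q n)) \<longlonglongrightarrow> 0"
    by (rule tendsto_sandwich[OF _ _ tendsto_const, rotated 2])
       (auto simp: merge_error_def l1_dist_nonneg intro!: eventually_mono[OF eventually_gt_at_top[of 0]] err[unfolded merge_error_def])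
  moreover have "(\<lambda>n. (real (k n) - real (l n)) / real n) \<longlonglongrightarrow> rate"
  proof (rule tendsto_sandwich)
    \<comment> \<open>Truncation at 0 can lift \<open>l n\<close> above
      \<open>n * (- h2 - 2 * \<delta> n)\<close>, but not above \<open>n * (- h2)\<close>, so the
      lower bound keeps only the \<delta> terms of \<open>k n\<close>. The summand 2 absorbs the two
      roundings.\<close>
    have "n * (h2 - h1 + 2 * \<delta> n) \<le> real (k n) - real (l n)
        \<and> real (k n) - real (l n) \<le> n * (h2 - h1 + 4 * \<delta> n) + 2" for n
    proof -
      have \<delta>: "\<delta> n \<ge> 0" by (simp add: \<delta>_def)
      have 0: "n * (- h1 + 2 * \<delta> n) \<ge> 0" "n * (- h2) \<ge> 0" "n * (2 * \<delta> n) \<ge> 0"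
        using \<delta> h by (auto intro!: mult_nonneg_nonneg simp: mult_nonneg_nonpos)
      have "n * (- h1 + 2 * \<delta> n) \<le> k n" "k n \<le> n * (- h1 + 2 * \<delta> n) + 1"
        unfolding k_def using 0 by linarith+
      moreover have "n * (- h2 - 2 * \<delta> n) - 1 \<le> l n" unfolding l_def by linarith
      moreover have "l n \<le> n * (- h2)"
        using 0 by (cases "\<lfloor>n * (- h2 - 2 * \<delta> n)\<rfloor> \<ge> 0") (auto simp: l_def algebra_simps, linarith)
      ultimately show ?thesis by (simp add: algebra_simps)
    qed
    note bounds = this
    show "\<forall>\<^sub>F n in sequentially. h2 - h1 + 2 * \<delta> n \<le> (real (k n) - real (l n)) / real n"
      using eventually_gt_at_top[of 0]
      by eventually_elim (use bounds in \<open>auto simp: pos_le_divide_eq mult.commute\<close>)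
    show "\<forall>\<^sub>F n in sequentially. (real (k n) - real (l n)) / real n \<le> h2 - h1 + 4 * \<delta> n + 2 / real n"
      using eventually_gt_at_top[of 0]
    proof eventually_elim
      case (elim n)
      then have "(h2 - h1 + 4 * \<delta> n + 2 / real n) * real n = n * (h2 - h1 + 4 * \<delta> n) + 2"
        by (simp add: field_simps)
      with bounds[of n] elim show ?case by (simp add: pos_divide_le_eq)
    qed
    show "(\<lambda>n. h2 - h1 + 2 * \<delta> n) \<longlonglongrightarrow> rate" unfolding rate \<delta>_def by real_asymp
    show "(\<lambda>n. h2 - h1 + 4 * \<delta> n + 2 / real n) \<longlonglongrightarrow> rate" unfolding rate \<delta>_def by real_asymp
  qed
  ultimately show ?thesis unfolding merging_achievable_def by blast
qed

end

theorem theorem1: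
  fixes P :: "('x::finite \<times> 'y::finite \<times> 'z::finite) pmf" and PE :: "'e pmf"
  assumes "bi_disjoint (map_pmf (\<lambda>(x, y, z). ((x, y), z)) P)"
  shows "merging_achievable P PE
           (mutual_info (map_pmf (\<lambda>(x, y, z). (x, z)) P) - mutual_info (map_pmf (\<lambda>(x, y, z). (x, y)) P))
       \<and> (\<forall>R. merging_achievable P PE R \<longrightarrow>
           R \<ge> mutual_info (map_pmf (\<lambda>(x, y, z). (x, z)) P) - mutual_info (map_pmf (\<lambda>(x, y, z). (x, y)) P))"
proof -
  obtain \<phi> \<psi> K where "bi_disjoint_source P \<phi> \<psi> K"
    using bi_disjoint_sourceI[OF assms] .
  then interpret bi_disjoint_source P \<phi> \<psi> K .
  show ?thesis
    using achievability converse unfolding rate_def by blast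
qed

end
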